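(* A relational representation $r:\mathrm{Pen}\to\mathcal Q(X)$ of the quantale $\mathrm{Pen}$ of Penrose tilings is algebraically irreducible if, and only if, it is equivalent to the relational representation $\rho_x:\mathrm{Pen}\to\mathcal Q(x)$ canonically determined by an equivalence class $x\in K/{\sim}$ of Penrose sequences, by which is meant the unique relational representation of $\mathrm{Pen}$ on the set $x\subseteq K$ for which the canonical mapping $\mathrm{seq}:x\to K$ is the inclusion of $x$ into $K$. In particular, the relational points of $\mathrm{Pen}$ (i.e. the equivalence classes of algebraically irreducible relational representations of $\mathrm{Pen}$) are in canonical bijective correspondence with the equivalence classes of Penrose sequences.
   Context: Quantales: "quantale" means unital involutive quantale: a sup-lattice $Q$ (poset with all joins) with an associative multiplication $\&$ preserving arbitrary joins in each variable, a unit $e$, and a join-preserving involution ${}^*$ with $a^{**}=a$, $(a\& b)^*=b^*\& a^*$. Bottom is $0$, top is $1$. A homomorphism $h$ preserves all joins, multiplication, involution and satisfies $h(e)\ge e$ (strictly unital if $h(e)=e$). Relational representations: $\mathcal Q(X)$ is the quantale of binary relations on a set $X$ ordered by inclusion, $R\& S=\{(x,z):\exists y,\ xRy,\ ySz\}$, unit $\Delta_X$, involution the converse. A relational representation of $Q$ on $X$ is a homomorphism $r:Q\to\mathcal Q(X)$; write $x\langle a\rangle y$ (or $x\,a\,y$) for $(x,y)\in r(a)$, and $Za=\{y: \exists z\in Z,\ z\langle a\rangle y\}$ for $Z\subseteq X$. It is algebraically irreducible if $X\ne\emptyset$ and $\{\{x\}a: a\in Q\}=\mathcal P(X)$ for each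 $x\in X$. Representations on $X$ and $X'$ are equivalent if there is a sup-lattice isomorphism $f:\mathcal P(X)\to\mathcal P(X')$ with $f(Za)=f(Z)a$ and $Y\cap Z=\emptyset\iff f(Y)\cap f(Z)=\emptyset$. The quantale $\mathrm{Pen}$: it is the quantale presented by generators $\langle A^{(n)}|$ ($n\in\mathbb N=\{0,1,2,\dots\}$, $A\in\{S,L\}$), where $|A^{(n)}\rangle:=\langle A^{(n)}|^*$, juxtaposition denotes $\&$, and the relations are, for all $n$ and $A,B\in\{S,L\}$: (C1) $\langle L^{(n)}|\,|S^{(n)}\rangle\le 0$; (C2) $\langle S^{(n)}|\le\langle L^{(n+1)}|$; (D1) $e\le\langle L^{(n)}|\vee\langle S^{(n)}|$; (D2) $|A^{(n+1)}\rangle\langle A^{(n+1)}|\le\langle S^{(n)}|\vee\langle L^{(n)}|$; (E1) $\langle B^{(n)}|\langle A^{(n+1)}|\le\langle A^{(n+1)}|$; (E2) $\langle A^{(n+1)}|\langle B^{(n)}|\le\langle A^{(n+1)}|$; (E3) $|B^{(n)}\rangle\langle A^{(n+1)}|\le\langle A^{(n+1)}|$; (E4) $\langle A^{(n+1)}|\,|B^{(n)}\rangle\le\langle A^{(n+1)}|$; (C') $e\le\langle A_n^{(n)}|\cdots\langle A_0^{(0)}|\,|A_0^{(0)}\rangle\cdots|A_n^{(n)}\rangle$ for every string $A_0,\dots,A_n\in\{S,L\}$ that is admissible ($A_i=S$ implies $A_{i+1}=L$ for $0\le i<n$) and has $A_n=L$. That is, for any quantale $Q$ and any family of elements of $Q$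 satisfying the corresponding inequalities there is a unique strictly unital homomorphism $\mathrm{Pen}\to Q$ sending the generators to these elements. Penrose sequences: $K$ is the set of $s\in\{0,1\}^{\mathbb N}$ such that $s_n=1$ implies $s_{n+1}=0$; $s\sim t$ iff there is $m$ with $s_n=t_n$ for all $n\ge m$. For a relational representation of $\mathrm{Pen}$ on $X$ and $x\in X$, for each $n$ exactly one of $x\langle L^{(n)}|x$, $x\langle S^{(n)}|x$ holds, and the tiling sequence $\mathrm{seq}(x)\in K$ is defined by $\mathrm{seq}(x)_n=0$ if $x\langle L^{(n)}|x$ and $\mathrm{seq}(x)_n=1$ if $x\langle S^{(n)}|x$. *)

theory Defs
  imports Main
begin

section \<open>Unital involutive quantales\<close>

text \<open>
  Multiplication is written \<open>*\<close> and the unit \<open>e\<close> is written \<open>1\<close>. The bottom and top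
  elements are \<open>bot\<close> and \<open>top\<close>; in particular the \<open>1\<close> below is the unit, not the top.
\<close>

class quantale = complete_lattice + monoid_mult +
  fixes invol :: "'a \<Rightarrow> 'a"  ("_\<^sup>\<star>" [1000] 1000)
  assumes Sup_mult: "Sup A * b = (SUP a\<in>A. a * b)"
    and mult_Sup: "b * Sup A = (SUP a\<in>A. b * a)"
    and invol_Sup: "(Sup A)\<^sup>\<star> = (SUP a\<in>A. a\<^sup>\<star>)"
    and invol_invol [simp]: "a\<^sup>\<star>\<^sup>\<star> = a"
    and invol_mult: "(a * b)\<^sup>\<star> = b\<^sup>\<star> * a\<^sup>\<star>"
begin

lemma mult_mono_left: "a \<le> b \<Longrightarrow> a * c \<le> b * c"
  using Sup_mult[of "{a, b}" c] by (simp add: sup.absorb2 sup.orderI le_iff_sup)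

lemma mult_mono_right: "a \<le> b \<Longrightarrow> c * a \<le> c * b"
  using mult_Sup[of c "{a, b}"] by (simp add: sup.absorb2 sup.orderI le_iff_sup)

lemma quantale_mult_mono: "a \<le> b \<Longrightarrow> c \<le> d \<Longrightarrow> a * c \<le> b * d"
  using mult_mono_left mult_mono_right order_trans by blast

lemma invol_mono: "a \<le> b \<Longrightarrow> a\<^sup>\<star> \<le> b\<^sup>\<star>"
  using invol_Sup[of "{a, b}"] by (simp add: sup.absorb2 sup.orderI le_iff_sup)

lemma invol_one [simp]: "1\<^sup>\<star> = 1"
  by (metis invol_invol invol_mult mult_1_left mult_1_right)

end

definition quantale_hom :: "('a::quantale \<Rightarrow> 'b::quantale) \<Rightarrow> bool" where
  "quantale_hom h \<longleftrightarrow>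
     (\<forall>A. h (Sup A) = (SUP a\<in>A. h a)) \<and>
     (\<forall>a b. h (a * b) = h a * h b) \<and>
     (\<forall>a. h (a\<^sup>\<star>) = (h a)\<^sup>\<star>) \<and>
     1 \<le> h 1"

definition strictly_unital_hom :: "('a::quantale \<Rightarrow> 'b::quantale) \<Rightarrow> bool" where
  "strictly_unital_hom h \<longleftrightarrow> quantale_hom h \<and> h 1 = 1"


section \<open>Free quantales\<close>

text \<open>
  The free unital involutive quantale on \<open>'g\<close> is the power set of the free involutive monoid,
  whose elements are the words over generators and formal adjoints of generators.
\<close>

datatype 'g letter = Gen 'g | Adj 'g

fun flip :: "'g letter \<Rightarrow> 'g letter" where
  "flip (Gen g) = Adj g"
| "flip (Adj g) = Gen g"

lemma flip_flip [simp]: "flip (flip l) = l"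
  by (cases l) auto

definition adj_word :: "'g letter list \<Rightarrow> 'g letter list" where
  "adj_word w = rev (map flip w)"

lemma adj_word_adj_word [simp]: "adj_word (adj_word w) = w"
  by (simp add: adj_word_def rev_map comp_def)

lemma adj_word_append: "adj_word (v @ w) = adj_word w @ adj_word v"
  by (simp add: adj_word_def)

typedef 'g free_quantale = "UNIV :: 'g letter list set set" ..

setup_lifting type_definition_free_quantale

instantiation free_quantale :: (type) quantale
begin

lift_definition less_eq_free_quantale :: "'a free_quantale \<Rightarrow> 'a free_quantale \<Rightarrow> bool" is "(\<subseteq>)" .
lift_definition less_free_quantale :: "'a free_quantale \<Rightarrow> 'a free_quantale \<Rightarrow> bool" is "(\<subset>)" .
lift_definition Sup_free_quantale :: "'a free_quantale set \<Rightarrow> 'a free_quantale" is Union .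
lift_definition Inf_free_quantale :: "'a free_quantale set \<Rightarrow> 'a free_quantale" is Inter .
lift_definition sup_free_quantale :: "'a free_quantale \<Rightarrow> 'a free_quantale \<Rightarrow> 'a free_quantale" is "(\<union>)" .
lift_definition inf_free_quantale :: "'a free_quantale \<Rightarrow> 'a free_quantale \<Rightarrow> 'a free_quantale" is "(\<inter>)" .
lift_definition bot_free_quantale :: "'a free_quantale" is "{}" .
lift_definition top_free_quantale :: "'a free_quantale" is UNIV .
lift_definition one_free_quantale :: "'a free_quantale" is "{[]}" .
lift_definition times_free_quantale :: "'a free_quantale \<Rightarrow> 'a free_quantale \<Rightarrow> 'a free_quantale"
  is "\<lambda>V W. {v @ w | v w. v \<in> V \<and> w \<in> W}" .
lift_definition invol_free_quantale :: "'a free_quantale \<Rightarrow> 'a free_quantale"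
  is "\<lambda>W. adj_word ` W" .

instance
proof
  fix a b c :: "'a free_quantale" and A :: "'a free_quantale set"
  show "a * b * c = a * (b * c)"
    by transfer (auto; metis append_assoc)
  show "1 * a = a" "a * 1 = a"
    by (transfer; auto)+
  show "Sup A * b = (SUP a\<in>A. a * b)" "b * Sup A = (SUP a\<in>A. b * a)"
    by (transfer; auto)+
  show "(Sup A)\<^sup>\<star> = (SUP a\<in>A. a\<^sup>\<star>)"
    by transfer auto
  show "a\<^sup>\<star>\<^sup>\<star> = a"
    by transfer (simp add: image_image)
  show "(a * b)\<^sup>\<star> = b\<^sup>\<star> * a\<^sup>\<star>"
    by transfer (auto simp: adj_word_append image_iff; metis adj_word_append)
qed (transfer; auto)+

end

lift_definition free_gen :: "'g \<Rightarrow> 'g free_quantale" is "\<lambda>g. {[Gen g]}" .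


section \<open>Quantales presented by generators and relations\<close>

text \<open>
  For a relation \<open>R\<close> on a quantale, read as a set of inequalities to be imposed, \<open>quant_le R\<close>
  is the least preorder that contains \<open>R\<close> and the order of the quantale and is compatible with
  joins, multiplication and involution. The congruence \<open>quant_cong R\<close> it induces is the one by
  which the quantale has to be divided in order to impose \<open>R\<close>.
\<close>

inductive quant_le :: "('q::quantale \<Rightarrow> 'q \<Rightarrow> bool) \<Rightarrow> 'q \<Rightarrow> 'q \<Rightarrow> bool" for R where
  rel: "R u v \<Longrightarrow> quant_le R u v"
| le: "u \<le> v \<Longrightarrow> quant_le R u v"
| trans: "quant_le R u v \<Longrightarrow> quant_le R v w \<Longrightarrow> quant_le R u w"
| Sup: "(\<And>u. u \<in> A \<Longrightarrow> quant_le R u v) \<Longrightarrow> quant_le R (Sup A) v"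
| mult: "quant_le R u v \<Longrightarrow> quant_le R u' v' \<Longrightarrow> quant_le R (u * u') (v * v')"
| invol: "quant_le R u v \<Longrightarrow> quant_le R (u\<^sup>\<star>) (v\<^sup>\<star>)"

definition quant_cong :: "('q::quantale \<Rightarrow> 'q \<Rightarrow> bool) \<Rightarrow> 'q \<Rightarrow> 'q \<Rightarrow> bool" where
  "quant_cong R u v \<longleftrightarrow> quant_le R u v \<and> quant_le R v u"

lemma equivp_quant_cong: "equivp (quant_cong R)"
  by (rule equivpI) (auto simp: reflp_def symp_def transp_def quant_cong_def
      intro: quant_le.le quant_le.trans)

lemma quant_le_cong:
  "quant_cong R u u' \<Longrightarrow> quant_cong R v v' \<Longrightarrow> quant_le R u v = quant_le R u' v'"
  unfolding quant_cong_def by (blast intro: quant_le.trans)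

lemma quant_cong_mult:
  "quant_cong R u u' \<Longrightarrow> quant_cong R v v' \<Longrightarrow> quant_cong R (u * v) (u' * v')"
  unfolding quant_cong_def by (blast intro: quant_le.mult)

lemma quant_cong_invol: "quant_cong R u v \<Longrightarrow> quant_cong R (u\<^sup>\<star>) (v\<^sup>\<star>)"
  unfolding quant_cong_def by (blast intro: quant_le.invol)

lemma quant_le_Sup_upper: "u \<in> A \<Longrightarrow> quant_le R u (Sup A)"
  by (simp add: Sup_upper quant_le.le)

lemma quant_cong_Sup:
  assumes "rel_set (quant_cong R) A B"
  shows "quant_cong R (Sup A) (Sup B)"
  using assms unfolding rel_set_def quant_cong_def
  by (meson quant_le.Sup quant_le.trans quant_le_Sup_upper)


section \<open>The quantale of Penrose tilings\<close>

datatype tile = L | S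

definition admissible :: "nat \<Rightarrow> (nat \<Rightarrow> tile) \<Rightarrow> bool" where
  "admissible n A \<longleftrightarrow> (\<forall>i<n. A i = S \<longrightarrow> A (Suc i) = L)"

text \<open>
  The defining relations, as inequalities between elements of an arbitrary quantale in which the
  generator \<open>\<langle>A\<^bsup>(n)\<^esup>|\<close> is interpreted as \<open>b A n\<close>, and hence \<open>|A\<^bsup>(n)\<^esup>\<rangle>\<close> as \<open>(b A n)\<^sup>\<star>\<close>.
  In \<open>C'\<close> only the values \<open>A 0, \<dots>, A n\<close> of the sequence \<open>A\<close> are relevant.
\<close>

inductive pen_rel :: "(tile \<Rightarrow> nat \<Rightarrow> 'q::quantale) \<Rightarrow> 'q \<Rightarrow> 'q \<Rightarrow> bool" for b where
  C1: "pen_rel b (b L n * (b S n)\<^sup>\<star>) bot"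
| C2: "pen_rel b (b S n) (b L (Suc n))"
| D1: "pen_rel b 1 (sup (b L n) (b S n))"
| D2: "pen_rel b ((b A (Suc n))\<^sup>\<star> * b A (Suc n)) (sup (b S n) (b L n))"
| E1: "pen_rel b (b B n * b A (Suc n)) (b A (Suc n))"
| E2: "pen_rel b (b A (Suc n) * b B n) (b A (Suc n))"
| E3: "pen_rel b ((b B n)\<^sup>\<star> * b A (Suc n)) (b A (Suc n))"
| E4: "pen_rel b (b A (Suc n) * (b B n)\<^sup>\<star>) (b A (Suc n))"
| C': "admissible n A \<Longrightarrow> A n = L \<Longrightarrow>
    pen_rel b 1
      (prod_list (map (\<lambda>i. b (A i) i) (rev [0..<Suc n])) *
       prod_list (map (\<lambda>i. (b (A i) i)\<^sup>\<star>) [0..<Suc n]))"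

abbreviation free_bra :: "tile \<Rightarrow> nat \<Rightarrow> (tile \<times> nat) free_quantale" where
  "free_bra A n \<equiv> free_gen (A, n)"

quotient_type pen = "(tile \<times> nat) free_quantale" / "quant_cong (pen_rel free_bra)"
  by (rule equivp_quant_cong)

instantiation pen :: quantale
begin

lift_definition less_eq_pen :: "pen \<Rightarrow> pen \<Rightarrow> bool" is "quant_le (pen_rel free_bra)"
  by (rule quant_le_cong)

lift_definition Sup_pen :: "pen set \<Rightarrow> pen" is Sup
  by (rule quant_cong_Sup)

lift_definition one_pen :: pen is 1 .

lift_definition times_pen :: "pen \<Rightarrow> pen \<Rightarrow> pen" is "(*)"
  by (rule quant_cong_mult)

lift_definition invol_pen :: "pen \<Rightarrow> pen" is invol
  by (rule quant_cong_invol)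

definition less_pen :: "pen \<Rightarrow> pen \<Rightarrow> bool" where
  "less_pen a b \<longleftrightarrow> a \<le> b \<and> \<not> b \<le> a"
definition Inf_pen :: "pen set \<Rightarrow> pen" where
  "Inf_pen A = Sup {b. \<forall>a\<in>A. b \<le> a}"
definition sup_pen :: "pen \<Rightarrow> pen \<Rightarrow> pen" where
  "sup_pen a b = Sup {a, b}"
definition inf_pen :: "pen \<Rightarrow> pen \<Rightarrow> pen" where
  "inf_pen a b = Sup {c. c \<le> a \<and> c \<le> b}"
definition bot_pen :: pen where
  "bot_pen = Sup {}"
definition top_pen :: pen where
  "top_pen = Sup UNIV"

lemma le_abs_pen: "abs_pen u \<le> abs_pen v \<longleftrightarrow> quant_le (pen_rel free_bra) u v"
  by (rule less_eq_pen.abs_eq)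

lemma Sup_abs_pen: "Sup (abs_pen ` U) = abs_pen (Sup U)"
proof -
  have "quant_cong (pen_rel free_bra) (rep_pen (abs_pen u)) u" for u
    by (intro Quotient3_rep_abs[OF Quotient3_pen] equivp_reflp[OF equivp_quant_cong])
  then have "rel_set (quant_cong (pen_rel free_bra)) (rep_pen ` abs_pen ` U) U"
    unfolding rel_set_def by blast
  then show ?thesis
    unfolding Sup_pen_def map_fun_def
    by (metis comp_apply quant_cong_Sup Quotient3_rel_abs[OF Quotient3_pen])
qed

lemma Sup_pen_eq: "Sup A = abs_pen (Sup (rep_pen ` A))"
  by (simp add: Sup_pen_def)

lemma abs_rep_pen: "abs_pen (rep_pen a) = a"
  by (rule Quotient3_abs_rep[OF Quotient3_pen])

lemma pen_cases:
  obtains u where "a = abs_pen u"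
  by (metis abs_rep_pen)

instance
proof
  fix a b c :: pen and A :: "pen set"
  show "a \<le> a" for a :: pen
    by (cases a rule: pen_cases) (simp add: le_abs_pen quant_le.le)
  show "a \<le> b \<Longrightarrow> b \<le> c \<Longrightarrow> a \<le> c"
    by (cases a rule: pen_cases; cases b rule: pen_cases; cases c rule: pen_cases)
      (auto simp: le_abs_pen intro: quant_le.trans)
  show "a \<le> b \<Longrightarrow> b \<le> a \<Longrightarrow> a = b"
    by (cases a rule: pen_cases; cases b rule: pen_cases)
      (auto simp: le_abs_pen pen.abs_eq_iff quant_cong_def)
  show "(a < b) = (a \<le> b \<and> \<not> b \<le> a)"
    by (rule less_pen_def)
  have upper: "a \<le> Sup A" if "a \<in> A" for a :: pen and A
    using le_abs_pen[of "rep_pen a" "Sup (rep_pen ` A)"] that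
    by (simp add: Sup_pen_eq abs_rep_pen quant_le_Sup_upper)
  have least: "Sup A \<le> b" if "\<And>a. a \<in> A \<Longrightarrow> a \<le> b" for b :: pen and A
  proof -
    have "quant_le (pen_rel free_bra) (Sup (rep_pen ` A)) (rep_pen b)"
      using that by (intro quant_le.Sup) (auto simp: less_eq_pen.rep_eq)
    then show ?thesis
      using le_abs_pen[of "Sup (rep_pen ` A)" "rep_pen b"] by (simp add: Sup_pen_eq abs_rep_pen)
  qed
  show "a \<in> A \<Longrightarrow> a \<le> Sup A" "(\<And>a. a \<in> A \<Longrightarrow> a \<le> b) \<Longrightarrow> Sup A \<le> b"
    by (auto intro: upper least)
  show "a \<in> A \<Longrightarrow> Inf A \<le> a" "(\<And>a. a \<in> A \<Longrightarrow> b \<le> a) \<Longrightarrow> b \<le> Inf A"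
    by (auto simp: Inf_pen_def intro: upper least)
  show "a \<le> sup a b" "b \<le> sup a b" "b \<le> a \<Longrightarrow> c \<le> a \<Longrightarrow> sup b c \<le> a"
    by (auto simp: sup_pen_def intro: upper least)
  show "inf a b \<le> a" "inf a b \<le> b" "a \<le> b \<Longrightarrow> a \<le> c \<Longrightarrow> a \<le> inf b c"
    by (auto simp: inf_pen_def intro: upper least)
  show "Inf {} = (top :: pen)" "Sup {} = (bot :: pen)"
    by (simp_all add: Inf_pen_def top_pen_def bot_pen_def)
  show "a * b * c = a * (b * c)"
    by (cases a rule: pen_cases; cases b rule: pen_cases; cases c rule: pen_cases)
      (simp add: times_pen.abs_eq mult.assoc)
  show "1 * a = a" "a * 1 = a"
    by (cases a rule: pen_cases; simp add: times_pen.abs_eq one_pen_def)+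
  show "a\<^sup>\<star>\<^sup>\<star> = a"
    by (cases a rule: pen_cases) (simp add: invol_pen.abs_eq)
  show "(a * b)\<^sup>\<star> = b\<^sup>\<star> * a\<^sup>\<star>"
    by (cases a rule: pen_cases; cases b rule: pen_cases)
      (simp add: times_pen.abs_eq invol_pen.abs_eq invol_mult)
  define U where "U = rep_pen ` A"
  have A: "A = abs_pen ` U"
    by (simp add: U_def image_image abs_rep_pen)
  obtain v where b: "b = abs_pen v"
    by (rule pen_cases)
  have "(\<lambda>a. a * b) ` A = abs_pen ` (\<lambda>u. u * v) ` U" "(\<lambda>a. b * a) ` A = abs_pen ` (\<lambda>u. v * u) ` U"
    "invol ` A = abs_pen ` invol ` U"
    by (simp_all add: A b image_image times_pen.abs_eq invol_pen.abs_eq)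
  then show "Sup A * b = (SUP a\<in>A. a * b)" "b * Sup A = (SUP a\<in>A. b * a)"
    "(Sup A)\<^sup>\<star> = (SUP a\<in>A. a\<^sup>\<star>)"
    by (simp_all only: Sup_abs_pen) (simp_all add: A b Sup_abs_pen times_pen.abs_eq
        invol_pen.abs_eq Sup_mult mult_Sup invol_Sup)
qed

end

lift_definition bra :: "tile \<Rightarrow> nat \<Rightarrow> pen" is free_bra .


subsection \<open>The universal property\<close>

definition penrose_family :: "(tile \<Rightarrow> nat \<Rightarrow> 'q::quantale) \<Rightarrow> bool" where
  "penrose_family b \<longleftrightarrow> (\<forall>u v. pen_rel b u v \<longrightarrow> u \<le> v)"

lemma strictly_unital_homD:
  assumes "strictly_unital_hom h"
  shows "h (Sup A) = (SUP a\<in>A. h a)" "h (a * b) = h a * h b" "h (a\<^sup>\<star>) = (h a)\<^sup>\<star>" "h 1 = 1"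
    "h bot = bot" "h (sup a b) = sup (h a) (h b)" "a \<le> b \<Longrightarrow> h a \<le> h b"
    "h (prod_list as) = prod_list (map h as)"
proof -
  show *: "h (Sup A) = (SUP a\<in>A. h a)" "h (a * b) = h a * h b" "h (a\<^sup>\<star>) = (h a)\<^sup>\<star>" "h 1 = 1"
    for A a b
    using assms unfolding strictly_unital_hom_def quantale_hom_def by auto
  show "h bot = bot"
    using *(1)[of "{}"] by simp
  show sup: "h (sup a b) = sup (h a) (h b)" for a b
    using *(1)[of "{a, b}"] by simp
  show "a \<le> b \<Longrightarrow> h a \<le> h b"
    using sup[of a b] by (metis sup.orderI sup.absorb2 sup.cobounded1)
  show "h (prod_list as) = prod_list (map h as)"
    by (induction as) (simp_all add: *)
qed

lemma pen_rel_hom: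
  assumes h: "strictly_unital_hom h" and "pen_rel b u v"
  shows "pen_rel (\<lambda>A n. h (b A n)) (h u) (h v)"
  using assms(2)
proof cases
  case (C' n A)
  then show ?thesis
    using pen_rel.C'[of n A "\<lambda>A n. h (b A n)"]
    by (simp add: strictly_unital_homD[OF h] comp_def del: upt_Suc)
qed (simp_all add: strictly_unital_homD[OF h]
    pen_rel.C1[where b = "\<lambda>A n. h (b A n)"]
    pen_rel.C2[where b = "\<lambda>A n. h (b A n)"]
    pen_rel.D1[where b = "\<lambda>A n. h (b A n)"]
    pen_rel.D2[where b = "\<lambda>A n. h (b A n)"]
    pen_rel.E1[where b = "\<lambda>A n. h (b A n)"]
    pen_rel.E2[where b = "\<lambda>A n. h (b A n)"]
    pen_rel.E3[where b = "\<lambda>A n. h (b A n)"]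
    pen_rel.E4[where b = "\<lambda>A n. h (b A n)"])

lemma pen_rel_hom_lift:
  assumes h: "strictly_unital_hom h" and "pen_rel (\<lambda>A n. h (b A n)) u v"
  obtains u' v' where "pen_rel b u' v'" "u = h u'" "v = h v'"
proof -
  note hom = strictly_unital_homD[OF h]
  from assms(2) show thesis
  proof cases
    case (C1 n)
    show ?thesis
      by (rule that[OF pen_rel.C1[of b n]]) (simp_all add: C1 hom)
  next
    case (C2 n)
    show ?thesis
      by (rule that[OF pen_rel.C2[of b n]]) (simp_all add: C2 hom)
  next
    case (D1 n)
    show ?thesis
      by (rule that[OF pen_rel.D1[of b n]]) (simp_all add: D1 hom)
  next
    case (D2 A n)
    show ?thesis
      by (rule that[OF pen_rel.D2[of b A n]]) (simp_all add: D2 hom)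
  next
    case (E1 B n A)
    show ?thesis
      by (rule that[OF pen_rel.E1[of b B n A]]) (simp_all add: E1 hom)
  next
    case (E2 A n B)
    show ?thesis
      by (rule that[OF pen_rel.E2[of b A n B]]) (simp_all add: E2 hom)
  next
    case (E3 B n A)
    show ?thesis
      by (rule that[OF pen_rel.E3[of b B n A]]) (simp_all add: E3 hom)
  next
    case (E4 A n B)
    show ?thesis
      by (rule that[OF pen_rel.E4[of b A n B]]) (simp_all add: E4 hom)
  next
    case (C' n A)
    show ?thesis
      by (rule that[OF pen_rel.C'[of n A b]]) (simp_all add: C' hom comp_def del: upt_Suc)
  qed
qed

lemma strictly_unital_hom_abs_pen: "strictly_unital_hom abs_pen"
  unfolding strictly_unital_hom_def quantale_hom_def
  by (simp add: Sup_abs_pen times_pen.abs_eq invol_pen.abs_eq one_pen_def)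

lemma bra_eq: "bra A n = abs_pen (free_bra A n)"
  by (simp add: bra_def)

theorem penrose_family_bra: "penrose_family bra"
  unfolding penrose_family_def
proof (intro allI impI)
  fix u v
  assume "pen_rel bra u v"
  then have "pen_rel (\<lambda>A n. abs_pen (free_bra A n)) u v"
    by (simp add: bra_eq[symmetric])
  from pen_rel_hom_lift[OF strictly_unital_hom_abs_pen this]
  obtain u' v' where "pen_rel free_bra u' v'" "u = abs_pen u'" "v = abs_pen v'" .
  then show "u \<le> v"
    by (simp add: le_abs_pen quant_le.rel)
qed

fun eval_letter :: "('g \<Rightarrow> 'q::quantale) \<Rightarrow> 'g letter \<Rightarrow> 'q" where
  "eval_letter b (Gen g) = b g"
| "eval_letter b (Adj g) = (b g)\<^sup>\<star>"

definition eval_word :: "('g \<Rightarrow> 'q::quantale) \<Rightarrow> 'g letter list \<Rightarrow> 'q" where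
  "eval_word b w = prod_list (map (eval_letter b) w)"

lift_definition eval_free :: "('g \<Rightarrow> 'q::quantale) \<Rightarrow> 'g free_quantale \<Rightarrow> 'q"
  is "\<lambda>b W. SUP w\<in>W. eval_word b w" .

lemma eval_letter_flip: "eval_letter b (flip l) = (eval_letter b l)\<^sup>\<star>"
  by (cases l) simp_all

lemma eval_word_append: "eval_word b (v @ w) = eval_word b v * eval_word b w"
  by (simp add: eval_word_def)

lemma eval_word_adj: "eval_word b (adj_word w) = (eval_word b w)\<^sup>\<star>"
  by (induction w) (simp_all add: eval_word_def adj_word_def eval_letter_flip invol_mult)

lemma strictly_unital_hom_eval_free: "strictly_unital_hom (eval_free b)"
  unfolding strictly_unital_hom_def quantale_hom_def
proof (intro conjI allI)
  show "eval_free b (Sup A) = (SUP a\<in>A. eval_free b a)" for A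
    by transfer (auto intro!: antisym SUP_least intro: SUP_upper2 SUP_upper)
  show "eval_free b (u * v) = eval_free b u * eval_free b v" for u v
  proof transfer
    fix b :: "'a \<Rightarrow> 'b" and V W
    have "(SUP v\<in>V. eval_word b v) * (SUP w\<in>W. eval_word b w)
        = (SUP v\<in>V. SUP w\<in>W. eval_word b (v @ w))"
      by (simp add: Sup_mult mult_Sup image_image eval_word_append) (rule SUP_commute)
    also have "\<dots> = (SUP w\<in>{v @ w |v w. v \<in> V \<and> w \<in> W}. eval_word b w)"
      by (intro antisym SUP_least) (auto intro!: SUP_upper intro: SUP_upper2)
    finally show "(SUP w\<in>{v @ w |v w. v \<in> V \<and> w \<in> W}. eval_word b w)
        = (SUP v\<in>V. eval_word b v) * (SUP w\<in>W. eval_word b w)" ..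
  qed
  show "eval_free b (u\<^sup>\<star>) = (eval_free b u)\<^sup>\<star>" for u
    by transfer (simp add: invol_Sup image_image eval_word_adj)
  show one: "eval_free b 1 = 1"
    by transfer (simp add: eval_word_def)
  show "1 \<le> eval_free b 1"
    by (simp add: one)
qed

lemma eval_free_gen: "eval_free b (free_gen g) = b g"
  by transfer (simp add: eval_word_def)

lemma eval_free_mono:
  assumes b: "penrose_family b"
    and "quant_le (pen_rel free_bra) u v"
  shows "eval_free (\<lambda>(A, n). b A n) u \<le> eval_free (\<lambda>(A, n). b A n) v"
  using assms(2)
proof induction
  case (rel u v)
  then have "pen_rel b (eval_free (\<lambda>(A, n). b A n) u) (eval_free (\<lambda>(A, n). b A n) v)"
    using pen_rel_hom[OF strictly_unital_hom_eval_free, of free_bra u v "\<lambda>(A, n). b A n"]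
    by (simp add: eval_free_gen)
  then show ?case
    using b by (simp add: penrose_family_def)
next
  case (trans u v w)
  from trans.IH show ?case
    by (rule order_trans)
qed (simp_all add: strictly_unital_homD[OF strictly_unital_hom_eval_free]
    SUP_least quantale_mult_mono invol_mono)

lemma eval_free_unique:
  assumes h: "strictly_unital_hom h"
  shows "h u = eval_free (\<lambda>g. h (free_gen g)) u"
proof -
  define word where "word = (\<lambda>w :: 'a letter list. Abs_free_quantale {w})"
  have u: "u = Sup (word ` Rep_free_quantale u)" for u
    unfolding word_def Sup_free_quantale_def
    by (simp add: image_image Abs_free_quantale_inverse Rep_free_quantale_inverse)
  have Nil: "word [] = 1"
    by (simp add: word_def one_free_quantale_def)
  have Cons: "word (l # w) = word [l] * word w" for l w
    by (simp add: word_def times_free_quantale_def Abs_free_quantale_inverse)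
  have letter: "h (word [l]) = eval_letter (\<lambda>g. h (free_gen g)) l" for l
  proof (cases l)
    case (Gen g)
    then show ?thesis
      by (simp add: word_def free_gen_def)
  next
    case (Adj g)
    have "word [Adj g] = (free_gen g)\<^sup>\<star>"
      by (simp add: word_def free_gen_def invol_free_quantale_def Abs_free_quantale_inverse adj_word_def)
    with Adj show ?thesis
      by (simp add: strictly_unital_homD[OF h])
  qed
  have "h (word w) = eval_word (\<lambda>g. h (free_gen g)) w" for w
  proof (induction w)
    case (Cons l w)
    then show ?case
      by (subst \<open>\<And>l w. word (l # w) = word [l] * word w\<close>)
        (simp add: strictly_unital_homD[OF h] letter eval_word_def)
  qed (simp add: Nil strictly_unital_homD[OF h] eval_word_def)
  then have "h (Sup (word ` Rep_free_quantale u)) = eval_free (\<lambda>g. h (free_gen g)) u"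
    by (simp add: strictly_unital_homD[OF h] image_image eval_free_def)
  with u[of u] show ?thesis
    by metis
qed

theorem pen_universal:
  assumes b: "penrose_family b"
  shows "\<exists>!h. strictly_unital_hom h \<and> (\<forall>A n. h (bra A n) = b A n)"
proof
  define h where "h = (\<lambda>a. eval_free (\<lambda>(A, n). b A n) (rep_pen a))"
  have abs: "h (abs_pen u) = eval_free (\<lambda>(A, n). b A n) u" for u
  proof -
    have "quant_cong (pen_rel free_bra) (rep_pen (abs_pen u)) u"
      by (intro Quotient3_rep_abs[OF Quotient3_pen] equivp_reflp[OF equivp_quant_cong])
    then show ?thesis
      unfolding h_def quant_cong_def by (blast intro: antisym eval_free_mono[OF b])
  qed
  note hom = strictly_unital_homD[OF strictly_unital_hom_eval_free]
  have "strictly_unital_hom h"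
    unfolding strictly_unital_hom_def quantale_hom_def
  proof (intro conjI allI)
    show "h (Sup A) = (SUP a\<in>A. h a)" for A
      by (simp add: Sup_pen_eq abs hom image_image) (simp add: h_def)
    show "h (x * y) = h x * h y" for x y
      by (cases x rule: pen_cases; cases y rule: pen_cases) (simp add: times_pen.abs_eq abs hom)
    show "h (x\<^sup>\<star>) = (h x)\<^sup>\<star>" for x
      by (cases x rule: pen_cases) (simp add: invol_pen.abs_eq abs hom)
    show "h 1 = 1"
      by (simp add: one_pen_def abs hom)
    then show "1 \<le> h 1"
      by simp
  qed
  then show "strictly_unital_hom h \<and> (\<forall>A n. h (bra A n) = b A n)"
    by (simp add: bra_eq abs eval_free_gen)
next
  fix h
  assume h: "strictly_unital_hom h \<and> (\<forall>A n. h (bra A n) = b A n)"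
  have "strictly_unital_hom (\<lambda>u. h (abs_pen u))"
    using h strictly_unital_hom_abs_pen
    unfolding strictly_unital_hom_def quantale_hom_def by (simp add: image_image)
  note unique = eval_free_unique[OF this]
  have "(\<lambda>g. h (abs_pen (free_gen g))) = (\<lambda>(A, n). b A n)"
    using h by (auto simp: bra_eq)
  with unique have *: "h (abs_pen u) = eval_free (\<lambda>(A, n). b A n) u" for u
    by metis
  show "h = (\<lambda>a. eval_free (\<lambda>(A, n). b A n) (rep_pen a))"
  proof
    show "h a = eval_free (\<lambda>(A, n). b A n) (rep_pen a)" for a
      using *[of "rep_pen a"] by (simp add: abs_rep_pen)
  qed
qed


section \<open>Relational representations\<close>

text \<open>
  \<open>rel_rep X r\<close> says that \<open>r\<close> is a homomorphism of quantales into the quantale of binary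
  relations on the set \<open>X\<close>, whose unit is the diagonal of \<open>X\<close>.
\<close>

definition rel_rep :: "'x set \<Rightarrow> ('q::quantale \<Rightarrow> 'x rel) \<Rightarrow> bool" where
  "rel_rep X r \<longleftrightarrow>
     (\<forall>a. r a \<subseteq> X \<times> X) \<and>
     (\<forall>A. r (Sup A) = (\<Union>a\<in>A. r a)) \<and>
     (\<forall>a b. r (a * b) = r a O r b) \<and>
     (\<forall>a. r (a\<^sup>\<star>) = (r a)\<inverse>) \<and>
     Id_on X \<subseteq> r 1"

definition alg_irreducible :: "'x set \<Rightarrow> ('q::quantale \<Rightarrow> 'x rel) \<Rightarrow> bool" where
  "alg_irreducible X r \<longleftrightarrow> X \<noteq> {} \<and> (\<forall>x\<in>X. {r a `` {x} | a. True} = Pow X)"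

definition rep_equivalent ::
  "'x set \<Rightarrow> ('q::quantale \<Rightarrow> 'x rel) \<Rightarrow> 'y set \<Rightarrow> ('q \<Rightarrow> 'y rel) \<Rightarrow> bool" where
  "rep_equivalent X r X' r' \<longleftrightarrow>
     (\<exists>f. bij_betw f (Pow X) (Pow X') \<and>
          (\<forall>\<Z>\<subseteq>Pow X. f (\<Union>\<Z>) = \<Union>(f ` \<Z>)) \<and>
          (\<forall>Z\<subseteq>X. \<forall>a. f (r a `` Z) = r' a `` f Z) \<and>
          (\<forall>Y\<subseteq>X. \<forall>Z\<subseteq>X. Y \<inter> Z = {} \<longleftrightarrow> f Y \<inter> f Z = {}))"

text \<open>
  The relational points of a quantale, as equivalence classes of algebraically irreducible
  representations on sets whose elements are taken from a type \<open>'x\<close>. The type stands in for the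
  class of all sets, so it must be large enough to contain a copy of every such representation.
\<close>

definition irreducible_reps :: "('x set \<times> ('q::quantale \<Rightarrow> 'x rel)) set" where
  "irreducible_reps = {(X, r). rel_rep X r \<and> alg_irreducible X r}"

definition rep_equivalence ::
  "(('x set \<times> ('q::quantale \<Rightarrow> 'x rel)) \<times> ('x set \<times> ('q \<Rightarrow> 'x rel))) set" where
  "rep_equivalence =
     {((X, r), (X', r')). (X, r) \<in> irreducible_reps \<and> (X', r') \<in> irreducible_reps \<and>
        rep_equivalent X r X' r'}"

definition relational_points :: "('x set \<times> ('q::quantale \<Rightarrow> 'x rel)) set set" where
  "relational_points = irreducible_reps // rep_equivalence"


section \<open>Penrose sequences\<close>

definition penrose_seqs :: "(nat \<Rightarrow> nat) set" where
  "penrose_seqs = {s. (\<forall>n. s n \<in> {0, 1}) \<and> (\<forall>n. s n = 1 \<longrightarrow> s (Suc n) = 0)}"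

definition tail_equivalence :: "((nat \<Rightarrow> nat) \<times> (nat \<Rightarrow> nat)) set" where
  "tail_equivalence =
     {(s, t). s \<in> penrose_seqs \<and> t \<in> penrose_seqs \<and> (\<exists>m. \<forall>n\<ge>m. s n = t n)}"

abbreviation penrose_classes :: "(nat \<Rightarrow> nat) set set" where
  "penrose_classes \<equiv> penrose_seqs // tail_equivalence"

text \<open>
  By \<open>tiling_seq_exactly_one\<close> below, the second alternative is the case \<open>x \<langle>S\<^bsup>(n)\<^esup>| x\<close>.
\<close>

definition tiling_seq :: "(pen \<Rightarrow> 'x rel) \<Rightarrow> 'x \<Rightarrow> nat \<Rightarrow> nat" where
  "tiling_seq r x n = (if (x, x) \<in> r (bra L n) then 0 else 1)"

lemma tiling_seq_exactly_one:
  assumes r: "rel_rep X r" and x: "x \<in> X"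
  shows "(x, x) \<in> r (bra S n) \<longleftrightarrow> (x, x) \<notin> r (bra L n)"
proof
  have Sup: "r (Sup A) = (\<Union>a\<in>A. r a)" for A
    using r by (simp add: rel_rep_def)
  have mono: "r a \<subseteq> r b" if "a \<le> b" for a b
    using Sup[of "{a, b}"] that by (auto simp: sup.absorb2)
  have "r (bra L n * (bra S n)\<^sup>\<star>) \<subseteq> r bot" "r 1 \<subseteq> r (sup (bra L n) (bra S n))"
    using penrose_family_bra by (auto simp: penrose_family_def intro!: mono pen_rel.C1 pen_rel.D1)
  moreover have "r bot = {}" "r (sup a b) = r a \<union> r b" for a b
    using Sup[of "{}"] Sup[of "{a, b}"] by auto
  ultimately have *: "r (bra L n) O (r (bra S n))\<inverse> = {}" "Id_on X \<subseteq> r (bra L n) \<union> r (bra S n)"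
    using r unfolding rel_rep_def by auto
  show "(x, x) \<in> r (bra S n) \<Longrightarrow> (x, x) \<notin> r (bra L n)"
    using *(1) by blast
  show "(x, x) \<notin> r (bra L n) \<Longrightarrow> (x, x) \<in> r (bra S n)"
    using *(2) x by blast
qed

definition canonical_rep :: "(nat \<Rightarrow> nat) set \<Rightarrow> pen \<Rightarrow> (nat \<Rightarrow> nat) rel" where
  "canonical_rep c = (THE r. rel_rep c r \<and> (\<forall>s\<in>c. tiling_seq r s = s))"

end

theory Submission
  imports Defs "HOL-Library.Countable_Set"
begin

text \<open>
  In a representation, \<open>x \<langle>A\<^bsup>(n)\<^esup>| y\<close> forces the sequence of \<open>y\<close> to have the entry \<open>A\<close> at \<open>n\<close> and the
  sequences of \<open>x\<close> and \<open>y\<close> to agree beyond \<open>n\<close>; the converse holds as soon as \<open>x\<close> and \<open>y\<close> are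
  related by some generator, since such a relation can be moved up the levels by \<open>E2\<close> and down by
  \<open>D2\<close>. By \<open>C'\<close>, every sequence tail equivalent to that of \<open>x\<close> is the sequence of some point reached
  from \<open>x\<close>. In an algebraically irreducible representation all points are related in this way and
  points with equal sequences cannot be separated by words in the generators, so that the sequence
  map is a bijection onto a class and determines the representation. Conversely, if it is such a
  bijection, the product of generators that spells the sequence of \<open>y\<close> leads from \<open>x\<close> to \<open>y\<close> only.
\<close>

section \<open>Quantales of relations\<close>

text \<open>A copy of \<open>'a rel\<close>, because the universal property of \<open>pen\<close>
  asks for a target type in class \<open>quantale\<close>, here with composition as its
  product.\<close>

typedef 'a relation = "UNIV :: 'a rel set" ..

setup_lifting type_definition_relation

instantiation relation :: (type) quantale
begin

lift_definition less_eq_relation :: "'a relation \<Rightarrow> 'a relation \<Rightarrow> bool" is "(\<subseteq>)" .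
lift_definition less_relation :: "'a relation \<Rightarrow> 'a relation \<Rightarrow> bool" is "(\<subset>)" .
lift_definition Sup_relation :: "'a relation set \<Rightarrow> 'a relation" is Union .
lift_definition Inf_relation :: "'a relation set \<Rightarrow> 'a relation" is Inter .
lift_definition sup_relation :: "'a relation \<Rightarrow> 'a relation \<Rightarrow> 'a relation" is "(\<union>)" .
lift_definition inf_relation :: "'a relation \<Rightarrow> 'a relation \<Rightarrow> 'a relation" is "(\<inter>)" .
lift_definition bot_relation :: "'a relation" is "{}" .
lift_definition top_relation :: "'a relation" is UNIV .
lift_definition one_relation :: "'a relation" is Id .
lift_definition times_relation :: "'a relation \<Rightarrow> 'a relation \<Rightarrow> 'a relation" is "(O)" .
lift_definition invol_relation :: "'a relation \<Rightarrow> 'a relation" is converse .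

instance
  by standard (transfer; auto)+

end

lemma Rep_relation_simps:
  "Rep_relation (Sup A) = (\<Union>a\<in>A. Rep_relation a)"
  "Rep_relation (a * b) = Rep_relation a O Rep_relation b"
  "Rep_relation (a\<^sup>\<star>) = (Rep_relation a)\<inverse>"
  "Rep_relation 1 = Id"
  "Rep_relation bot = {}"
  "Rep_relation (sup a b) = Rep_relation a \<union> Rep_relation b"
  by (transfer; auto)+


section \<open>Words in the generators\<close>

abbreviation pen_word :: "(tile \<times> nat) letter list \<Rightarrow> pen" where
  "pen_word \<equiv> eval_word (\<lambda>(A, n). bra A n)"

text \<open>Elements of the free quantale are sets of words, and \<open>pen\<close> is a quotient of
  it. A representation is therefore determined by its values on words.\<close>

lemma pen_eq_SUP_words:
  obtains W where "a = (SUP w\<in>W. pen_word w)"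
proof -
  obtain u where "a = abs_pen u"
    by (rule pen_cases)
  also have "\<dots> = eval_free (\<lambda>g. abs_pen (free_gen g)) u"
    by (rule eval_free_unique[OF strictly_unital_hom_abs_pen])
  also have "(\<lambda>g. abs_pen (free_gen g)) = (\<lambda>(A, n). bra A n)"
    by (auto simp: bra_eq)
  finally show thesis
    by (intro that[of "Rep_free_quantale u"]) (simp add: eval_free.rep_eq)
qed

text \<open>Levels run from \<open>n - 1\<close> down to 0, so the left factor in \<open>C'\<close>
  at \<open>n\<close> is \<open>chain b A (Suc n)\<close>.\<close>

definition chain :: "(tile \<Rightarrow> nat \<Rightarrow> 'q::quantale) \<Rightarrow> (nat \<Rightarrow> tile) \<Rightarrow> nat \<Rightarrow> 'q" where
  "chain b A n = prod_list (map (\<lambda>i. b (A i) i) (rev [0..<n]))"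

lemma chain_0 [simp]: "chain b A 0 = 1"
  and chain_Suc [simp]: "chain b A (Suc n) = b (A n) n * chain b A n"
  by (simp_all add: chain_def)

lemma invol_prod_list: "(prod_list as)\<^sup>\<star> = prod_list (map invol (rev as))"
  for as :: "'q::quantale list"
  by (induction as) (simp_all add: invol_mult)

lemma invol_chain: "(chain b A n)\<^sup>\<star> = prod_list (map (\<lambda>i. (b (A i) i)\<^sup>\<star>) [0..<n])"
  by (simp add: chain_def invol_prod_list rev_map comp_def)

text \<open>This is \<open>C'\<close> with its right factor recognised as the adjoint of the left
  one. In a representation it gives every point a successor under the chain.\<close>

lemma one_le_chain:
  assumes "penrose_family b" "admissible n A" "A n = L"
  shows "1 \<le> chain b A (Suc n) * (chain b A (Suc n))\<^sup>\<star>"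
  using pen_rel.C'[OF assms(2,3), of b] assms(1)
  unfolding invol_chain penrose_family_def by (simp add: chain_def del: upt_Suc)


section \<open>Penrose sequences\<close>

fun tile_bit :: "tile \<Rightarrow> nat" where
  "tile_bit L = 0"
| "tile_bit S = 1"

definition tile_of :: "nat \<Rightarrow> tile" where
  "tile_of k = (if k = 0 then L else S)"

lemma tile_bit_eq_iff [simp]: "tile_bit A = tile_bit B \<longleftrightarrow> A = B"
  by (cases A; cases B) auto

lemma tile_of_bit [simp]: "tile_of (tile_bit A) = A"
  by (cases A) (auto simp: tile_of_def)

lemma penrose_seq_cases:
  assumes "s \<in> penrose_seqs"
  obtains "s n = 0" | "s n = 1"
proof -
  have "s n \<in> {0, 1}"
    using assms by (simp add: penrose_seqs_def)
  with that show thesis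
    by auto
qed

lemma penrose_seq_Suc: "s \<in> penrose_seqs \<Longrightarrow> s n = 1 \<Longrightarrow> s (Suc n) = 0"
  by (simp add: penrose_seqs_def)

lemma tile_bit_tile_of: "s \<in> penrose_seqs \<Longrightarrow> tile_bit (tile_of (s n)) = s n"
  by (erule penrose_seq_cases[of s n]) (simp_all add: tile_of_def)

lemma admissible_tile_of:
  assumes s: "s \<in> penrose_seqs"
  shows "admissible n (\<lambda>i. tile_of (s i))"
  unfolding admissible_def
proof (intro allI impI)
  fix i assume "tile_of (s i) = S"
  then have "s i = 1"
    by (rule_tac penrose_seq_cases[OF s, of i]) (auto simp: tile_of_def)
  then show "tile_of (s (Suc i)) = L"
    by (simp add: tile_of_def penrose_seq_Suc[OF s])
qed

text \<open>The relation on sequences that interprets the generator \<open>bra A n\<close>. It is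
  not symmetric: the entry at \<open>n\<close> is prescribed for the target only.\<close>

definition pen_step :: "tile \<Rightarrow> nat \<Rightarrow> (nat \<Rightarrow> nat) \<Rightarrow> (nat \<Rightarrow> nat) \<Rightarrow> bool" where
  "pen_step A n s t \<longleftrightarrow> t n = tile_bit A \<and> (\<forall>m>n. s m = t m)"

lemma pen_step_tail_equivalence:
  assumes "pen_step A n s t" "s \<in> penrose_seqs" "t \<in> penrose_seqs"
  shows "(s, t) \<in> tail_equivalence"
proof -
  have "\<forall>m\<ge>Suc n. s m = t m"
    using assms(1) by (simp add: pen_step_def Suc_le_eq)
  with assms(2,3) show ?thesis
    unfolding tail_equivalence_def by blast
qed

section \<open>Tail equivalence and its classes\<close>

lemma equiv_tail_equivalence: "equiv penrose_seqs tail_equivalence"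
proof (rule equivI)
  show "tail_equivalence \<subseteq> penrose_seqs \<times> penrose_seqs"
    by (auto simp: tail_equivalence_def)
  show "refl_on penrose_seqs tail_equivalence"
    by (auto simp: refl_on_def tail_equivalence_def)
  show "sym tail_equivalence"
    by (auto simp: sym_def tail_equivalence_def) metis
  show "trans tail_equivalence"
  proof (rule transI)
    fix s t u
    assume "(s, t) \<in> tail_equivalence" "(t, u) \<in> tail_equivalence"
    then obtain k l where "s \<in> penrose_seqs" "u \<in> penrose_seqs"
      "\<forall>n\<ge>k. s n = t n" "\<forall>n\<ge>l. t n = u n"
      by (auto simp: tail_equivalence_def)
    then have "\<forall>n\<ge>max k l. s n = u n" "s \<in> penrose_seqs" "u \<in> penrose_seqs"
      by auto
    then show "(s, u) \<in> tail_equivalence"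
      unfolding tail_equivalence_def by blast
  qed
qed

lemma penrose_class_related:
  "c \<in> penrose_classes \<Longrightarrow> s \<in> c \<Longrightarrow> t \<in> c \<Longrightarrow> (s, t) \<in> tail_equivalence"
  by (meson equiv_tail_equivalence quotient_eq_iff)

lemma penrose_class_closed:
  "c \<in> penrose_classes \<Longrightarrow> s \<in> c \<Longrightarrow> (s, t) \<in> tail_equivalence \<Longrightarrow> t \<in> c"
  by (meson equiv_tail_equivalence in_quotient_imp_closed)

lemma penrose_class_nonempty: "c \<in> penrose_classes \<Longrightarrow> c \<noteq> {}"
  by (meson equiv_tail_equivalence in_quotient_imp_non_empty)

text \<open>At most one of two consecutive entries is 1, so the last common index can be chosen at an \<open>L\<close>.\<close>

lemma tail_equivalenceE:
  assumes "(s, t) \<in> tail_equivalence"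
  obtains n where "t n = 0" "\<forall>m>n. s m = t m"
proof -
  from assms obtain k where k: "\<forall>n\<ge>k. s n = t n" and t: "t \<in> penrose_seqs"
    by (auto simp: tail_equivalence_def)
  have "t k = 0 \<or> t (Suc k) = 0"
    using t by (auto simp: penrose_seqs_def)
  then show thesis
    using k that[of k] that[of "Suc k"] by (auto simp: less_imp_le)
qed

text \<open>Every member differs from a fixed one in a finite prefix only. Countability later allows
  a class to be copied into any infinite type.\<close>

lemma countable_penrose_class:
  assumes "c \<in> penrose_classes"
  shows "countable c"
proof -
  obtain t where t: "t \<in> c"
    using penrose_class_nonempty[OF assms] by blast
  define f where "f = (\<lambda>xs i. if i < length xs then xs ! i else t i :: nat)"
  have "c \<subseteq> range f"
  proof
    fix s assume "s \<in> c"
    with penrose_class_related[OF assms _ t] obtain k where "\<forall>n\<ge>k. s n = t n"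
      unfolding tail_equivalence_def by blast
    then have "s = f (map s [0..<k])"
      by (auto simp: f_def fun_eq_iff)
    then show "s \<in> range f"
      by blast
  qed
  then show ?thesis
    by (rule countable_subset) simp
qed


section \<open>Relational representations of the quantale of Penrose tilings\<close>

lemma tile_bit_tiling_seq [simp]: "tile_bit (tile_of (tiling_seq r x n)) = tiling_seq r x n"
  by (simp add: tiling_seq_def tile_of_def)

locale pen_representation =
  fixes X :: "'x set" and r :: "pen \<Rightarrow> 'x rel"
  assumes rel_rep: "rel_rep X r"
begin

abbreviation seq :: "'x \<Rightarrow> nat \<Rightarrow> nat" where
  "seq \<equiv> tiling_seq r"

section \<open>Axioms of a representation and loops of the generators\<close>

lemma subset: "r a \<subseteq> X \<times> X"
  and rep_Sup: "r (Sup A) = (\<Union>a\<in>A. r a)"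
  and rep_mult: "r (a * b) = r a O r b"
  and rep_invol: "r (a\<^sup>\<star>) = (r a)\<inverse>"
  and rep_one: "Id_on X \<subseteq> r 1"
  using rel_rep unfolding rel_rep_def by auto

lemma rep_sup: "r (sup a b) = r a \<union> r b"
  using rep_Sup[of "{a, b}"] by simp

lemma rep_mono: "a \<le> b \<Longrightarrow> r a \<subseteq> r b"
  by (metis rep_sup sup.absorb2 sup_ge1)

lemma rep_rel: "pen_rel bra a b \<Longrightarrow> r a \<subseteq> r b"
  using penrose_family_bra rep_mono[of a b] by (simp add: penrose_family_def)

lemma bra_diag: "x \<in> X \<Longrightarrow> (x, x) \<in> r (bra A n) \<longleftrightarrow> seq x n = tile_bit A"
  using tiling_seq_exactly_one[OF rel_rep, of x n] by (cases A) (auto simp: tiling_seq_def)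

lemma bra_tile_of: "x \<in> X \<Longrightarrow> (x, x) \<in> r (bra (tile_of (seq x n)) n)"
  by (simp add: bra_diag)

text \<open>The point \<open>y\<close> has a loop for its own tile at \<open>n\<close>. If that tile
  differed from \<open>A\<close>, generators for \<open>L\<close> and \<open>S\<close> would both
  lead into \<open>y\<close>, against \<open>C1\<close>.\<close>

lemma bra_target:
  assumes "(x, y) \<in> r (bra A n)"
  shows "seq y n = tile_bit A"
proof -
  have y: "y \<in> X"
    using assms subset by blast
  have "r (bra L n) O (r (bra S n))\<inverse> \<subseteq> r bot"
    using rep_rel[OF pen_rel.C1[of bra n]] by (simp add: rep_mult rep_invol)
  moreover have "r bot = {}"
    using rep_Sup[of "{}"] by simp
  ultimately have "\<not> ((x, y) \<in> r (bra L n) \<and> (y, y) \<in> r (bra S n))"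
    "\<not> ((y, y) \<in> r (bra L n) \<and> (x, y) \<in> r (bra S n))"
    by blast+
  with assms bra_tile_of[OF y, of n] have "tile_of (seq y n) = A"
    by (cases A; cases "tile_of (seq y n)") simp_all
  with bra_tile_of[OF y, of n] show ?thesis
    by (simp add: bra_diag[OF y])
qed

lemma seq_penrose: "x \<in> X \<Longrightarrow> seq x \<in> penrose_seqs"
  unfolding penrose_seqs_def
proof (intro CollectI conjI allI impI)
  assume x: "x \<in> X"
  show "seq x n \<in> {0, 1}" for n
    by (simp add: tiling_seq_def)
  fix n assume "seq x n = 1"
  then have "(x, x) \<in> r (bra S n)"
    using x by (simp add: bra_diag)
  then have "(x, x) \<in> r (bra L (Suc n))"
    using rep_rel[OF pen_rel.C2[of bra n]] by blast
  then show "seq x (Suc n) = 0"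
    using x by (simp add: bra_diag)
qed

text \<open>The loop of \<open>x\<close> at level \<open>Suc n\<close>, followed by the given arrow,
  is absorbed by \<open>E2\<close>.\<close>

lemma bra_up:
  assumes "(x, y) \<in> r (bra A n)"
  shows "(x, y) \<in> r (bra (tile_of (seq x (Suc n))) (Suc n))"
proof -
  have "(x, x) \<in> r (bra (tile_of (seq x (Suc n))) (Suc n))"
    using assms subset bra_tile_of by blast
  with assms show ?thesis
    using rep_rel[OF pen_rel.E2[of bra "tile_of (seq x (Suc n))" n A]] by (auto simp: rep_mult)
qed

lemma bra_up_le:
  assumes "(x, y) \<in> r (bra A n)" and "n \<le> m"
  shows "\<exists>B. (x, y) \<in> r (bra B m)"
  using assms(2)
proof (induction m rule: dec_induct)
  case base
  show ?case
    using assms(1) by blast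
next
  case (step m)
  then show ?case
    using bra_up by blast
qed

text \<open>Raised to level \<open>m\<close>, the arrow carries the tile of its source by
  \<open>bra_up\<close> and that of its target by \<open>bra_target\<close>.\<close>

lemma bra_seq_eq:
  assumes "(x, y) \<in> r (bra A n)" and "n < m"
  shows "seq x m = seq y m"
proof -
  obtain k where m: "m = Suc k" "n \<le> k"
    using \<open>n < m\<close> by (cases m) auto
  then obtain B where "(x, y) \<in> r (bra B k)"
    using bra_up_le[OF assms(1)] by blast
  then have "(x, y) \<in> r (bra (tile_of (seq x m)) m)"
    unfolding m by (rule bra_up)
  then have "seq y m = tile_bit (tile_of (seq x m))"
    by (rule bra_target)
  then show ?thesis
    by simp
qed

lemma pen_step_seq: "(x, y) \<in> r (bra A n) \<Longrightarrow> pen_step A n (seq x) (seq y)"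
  by (simp add: pen_step_def bra_target bra_seq_eq)

text \<open>Agreement at \<open>Suc n\<close> gives \<open>x\<close> a loop of the same generator.
  The adjoint of that loop followed by the arrow is an instance of the left side of
  \<open>D2\<close>.\<close>

lemma bra_down:
  assumes "(x, y) \<in> r (bra A (Suc n))" and "seq x (Suc n) = seq y (Suc n)"
  shows "(x, y) \<in> r (bra (tile_of (seq y n)) n)"
proof -
  have "(x, x) \<in> r (bra A (Suc n))"
    using assms bra_target[OF assms(1)] subset bra_diag[of x A "Suc n"] by auto
  then have "(x, y) \<in> r ((bra A (Suc n))\<^sup>\<star> * bra A (Suc n))"
    using assms(1) by (auto simp: rep_mult rep_invol)
  then have "(x, y) \<in> r (bra S n) \<union> r (bra L n)"
    using rep_rel[OF pen_rel.D2[of bra A n]] unfolding rep_sup by blast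
  then obtain B where "(x, y) \<in> r (bra B n)"
    by blast
  moreover from this have "B = tile_of (seq y n)"
    by (simp add: bra_target)
  ultimately show ?thesis
    by simp
qed

section \<open>Points related by a single generator\<close>

definition connected :: "'x \<Rightarrow> 'x \<Rightarrow> bool" where
  "connected x y \<longleftrightarrow> (\<exists>A n. (x, y) \<in> r (bra A n))"

lemma connected_refl: "x \<in> X \<Longrightarrow> connected x x"
  unfolding connected_def using bra_tile_of by blast

lemma connected_tail:
  assumes "connected x y"
  shows "(seq x, seq y) \<in> tail_equivalence"
proof -
  obtain A n where xy: "(x, y) \<in> r (bra A n)"
    using assms unfolding connected_def by blast
  then have "x \<in> X" "y \<in> X"
    using subset by blast+
  then show ?thesis
    by (intro pen_step_tail_equivalence[OF pen_step_seq[OF xy]] seq_penrose)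
qed

text \<open>For the converse, the arrow is raised to a high level and lowered again to
  \<open>n\<close>. Agreement beyond \<open>n\<close> is what each step of \<open>bra_down\<close>
  requires.\<close>

lemma connected_bra_iff:
  assumes "connected x y"
  shows "(x, y) \<in> r (bra A n) \<longleftrightarrow> pen_step A n (seq x) (seq y)"
proof
  assume step: "pen_step A n (seq x) (seq y)"
  obtain B k where "(x, y) \<in> r (bra B k)"
    using assms unfolding connected_def by blast
  \<comment> \<open>The level \<open>n + k\<close> is at least the given level \<open>k\<close>, and
    its distance \<open>k\<close> from the desired level \<open>n\<close> drives the
    induction.\<close>
  then obtain B where B: "(x, y) \<in> r (bra B (n + k))"
    using bra_up_le[of x y B k "n + k"] by auto
  have "\<exists>B. (x, y) \<in> r (bra B n)"
    using B
  proof (induction k arbitrary: B)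
    case (Suc k)
    have "seq x (Suc (n + k)) = seq y (Suc (n + k))"
      using step by (auto simp: pen_step_def)
    with Suc.prems have "(x, y) \<in> r (bra (tile_of (seq y (n + k))) (n + k))"
      by (intro bra_down) auto
    then show ?case
      by (rule Suc.IH)
  qed auto
  then obtain B where B: "(x, y) \<in> r (bra B n)" ..
  with step bra_target[OF B] show "(x, y) \<in> r (bra A n)"
    by (simp add: pen_step_def)
qed (rule pen_step_seq)

text \<open>Once both arrows are raised, the first to one level above the second, \<open>E2\<close>
  or \<open>E4\<close> absorbs the second into the first.\<close>

lemma connected_letter:
  assumes "connected x y" and "(y, z) \<in> r (eval_letter (\<lambda>(A, n). bra A n) l)"
  shows "connected x z"
proof -
  obtain A m B n where A: "(x, y) \<in> r (bra A m)"
    and B: "(y, z) \<in> r (bra B n) \<or> (z, y) \<in> r (bra B n)"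
    using assms by (cases l) (auto simp: connected_def rep_invol)
  define N where "N = max m n"
  obtain A' where "(x, y) \<in> r (bra A' N)"
    using bra_up_le[OF A, of N] by (auto simp: N_def)
  then obtain A' where A': "(x, y) \<in> r (bra A' (Suc N))"
    using bra_up by blast
  obtain B' where "(y, z) \<in> r (bra B' N) \<or> (z, y) \<in> r (bra B' N)"
    using B bra_up_le[of y z B n N] bra_up_le[of z y B n N] by (auto simp: N_def)
  then have "(x, z) \<in> r (bra A' (Suc N))"
    using A' rep_rel[OF pen_rel.E2[of bra A' N B']] rep_rel[OF pen_rel.E4[of bra A' N B']]
    by (auto simp: rep_mult rep_invol)
  then show ?thesis
    unfolding connected_def by blast
qed

section \<open>Words and chains in a representation\<close>

lemma rep_word_snoc:
  "r (pen_word (w @ [l])) = r (pen_word w) O r (eval_letter (\<lambda>(A, n). bra A n) l)"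
  by (simp add: eval_word_append rep_mult) (simp add: eval_word_def)

lemma rep_word_Nil: "r (pen_word []) = r 1"
  by (simp add: eval_word_def)

text \<open>\<open>r 1\<close> contains the diagonal but may be larger. Since every
  \<open>r a\<close> absorbs it on both sides, points related by it have the same loops.\<close>

lemma seq_one:
  assumes "(x, y) \<in> r 1"
  shows "seq x = seq y"
proof -
  have yx: "(y, x) \<in> r 1"
    using assms rep_invol[of 1] by auto
  have "r 1 O r a O r 1 = r a" for a
    using rep_mult[of 1 "a * 1"] rep_mult[of a 1] by simp
  then have "(x, x) \<in> r (bra L n) \<longleftrightarrow> (y, y) \<in> r (bra L n)" for n
    using assms yx by blast
  then show ?thesis
    by (auto simp: tiling_seq_def)
qed

text \<open>Each arrow sets the entry of its target at its own level and keeps those beyond. Levels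
  decrease along the chain, so an entry once set is not changed again.\<close>

lemma seq_chain:
  assumes "(x, y) \<in> r (chain bra A n)"
  shows "seq y m = (if m < n then tile_bit (A m) else seq x m)"
  using assms
proof (induction n arbitrary: x)
  case 0
  then show ?case
    by (simp add: seq_one)
next
  case (Suc n)
  then obtain z where z: "(x, z) \<in> r (bra (A n) n)" "(z, y) \<in> r (chain bra A n)"
    by (auto simp: rep_mult)
  show ?case
    using Suc.IH[OF z(2)] bra_target[OF z(1)] bra_seq_eq[OF z(1), of m] by (auto simp: less_Suc_eq)
qed

text \<open>\<open>E2\<close> absorbs the lower levels into the highest one. Points linked by a
  nonempty chain are thus related by a single generator.\<close>

lemma chain_le_bra: "r (chain bra A (Suc n)) \<subseteq> r (bra (A n) n)"
proof (induction n)
  case 0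
  then show ?case
    by simp
next
  case (Suc n)
  have "r (chain bra A (Suc (Suc n))) = r (bra (A (Suc n)) (Suc n)) O r (chain bra A (Suc n))"
    by (subst chain_Suc) (rule rep_mult)
  also have "\<dots> \<subseteq> r (bra (A (Suc n)) (Suc n)) O r (bra (A n) n)"
    using Suc.IH by blast
  also have "\<dots> \<subseteq> r (bra (A (Suc n)) (Suc n))"
    using rep_rel[OF pen_rel.E2[of bra "A (Suc n)" n "A n"]] by (simp add: rep_mult)
  finally show ?case .
qed

text \<open>The chain spelling \<open>t\<close> up to an index beyond which \<open>t\<close> agrees
  with the sequence of \<open>x\<close> has an end point by \<open>C'\<close>, and
  \<open>seq_chain\<close> forces the sequence of every such end point.\<close>

lemma chain_reaches:
  assumes x: "x \<in> X" and t: "(seq x, t) \<in> tail_equivalence"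
  obtains y A n where "(x, y) \<in> r (chain bra A (Suc n))"
    "\<forall>z. (x, z) \<in> r (chain bra A (Suc n)) \<longrightarrow> seq z = t"
proof -
  \<comment> \<open>For \<open>C'\<close> to apply, the top level of the chain must carry the tile
    \<open>L\<close>, hence an index with \<open>t n = 0\<close>.\<close>
  obtain n where n: "t n = 0" "\<forall>m>n. seq x m = t m"
    using tail_equivalenceE[OF t] by blast
  define A where "A = (\<lambda>i. tile_of (t i))"
  have t: "t \<in> penrose_seqs"
    using t by (simp add: tail_equivalence_def)
  have "admissible n A" "A n = L"
    using admissible_tile_of[OF t] n(1) by (simp_all add: A_def tile_of_def)
  then have "r 1 \<subseteq> r (chain bra A (Suc n) * (chain bra A (Suc n))\<^sup>\<star>)"
    by (intro rep_mono one_le_chain penrose_family_bra)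
  then have "(x, x) \<in> r (chain bra A (Suc n)) O (r (chain bra A (Suc n)))\<inverse>"
    using x rep_one unfolding rep_mult rep_invol by blast
  then obtain y where "(x, y) \<in> r (chain bra A (Suc n))"
    by blast
  moreover have "seq z = t" if "(x, z) \<in> r (chain bra A (Suc n))" for z
  proof
    fix m
    show "seq z m = t m"
      using seq_chain[OF that, of m] n by (auto simp: A_def tile_bit_tile_of t)
  qed
  ultimately show thesis
    by (intro that) blast+
qed

text \<open>Injectivity makes the chain that spells the sequence of \<open>y\<close> lead from
  \<open>x\<close> to \<open>y\<close> alone. Once all singletons arise, joins give every
  subset.\<close>

lemma alg_irreducible_if_bij:
  assumes c: "c \<in> penrose_classes" and bij: "bij_betw seq X c"
  shows "alg_irreducible X r"
  unfolding alg_irreducible_def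
proof (intro conjI ballI)
  show "X \<noteq> {}"
    using bij penrose_class_nonempty[OF c] by (auto simp: bij_betw_def)
  fix x assume x: "x \<in> X"
  have "\<exists>a. r a `` {x} = {y}" if y: "y \<in> X" for y
  proof -
    have "(seq x, seq y) \<in> tail_equivalence"
      using x y bij by (intro penrose_class_related[OF c]) (auto simp: bij_betw_def)
    then obtain y' A n where y': "(x, y') \<in> r (chain bra A (Suc n))"
      and uniq: "\<forall>z. (x, z) \<in> r (chain bra A (Suc n)) \<longrightarrow> seq z = seq y"
      by (rule chain_reaches[OF x])
    have "z = y" if "(x, z) \<in> r (chain bra A (Suc n))" for z
      using uniq that subset y by (intro inj_onD[OF bij_betw_imp_inj_on[OF bij]]) auto
    with y' have "r (chain bra A (Suc n)) `` {x} = {y}"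
      by blast
    then show ?thesis ..
  qed
  then obtain a where a: "\<And>y. y \<in> X \<Longrightarrow> r (a y) `` {x} = {y}"
    by metis
  have "\<exists>b. Y = r b `` {x}" if "Y \<subseteq> X" for Y
  proof -
    have "r (Sup (a ` Y)) `` {x} = (\<Union>y\<in>Y. r (a y) `` {x})"
      by (auto simp: rep_Sup)
    also have "\<dots> = (\<Union>y\<in>Y. {y})"
      using that by (intro SUP_cong a) auto
    finally show ?thesis
      by (metis UN_singleton)
  qed
  then show "{r a `` {x} |a. True} = Pow X"
    using subset by blast
qed

lemma bij_if_alg_irreducible:
  assumes "alg_irreducible X r"
  shows "\<exists>c\<in>penrose_classes. bij_betw seq X c"
proof -
  obtain x0 where x0: "x0 \<in> X"
    using assms by (auto simp: alg_irreducible_def)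
  have point: "\<exists>a. r a `` {x} = {y}" if "x \<in> X" "y \<in> X" for x y
  proof -
    have "{y} \<in> {r a `` {x} |a. True}"
      using assms that unfolding alg_irreducible_def by blast
    then show ?thesis
      by auto
  qed
  \<comment> \<open>Some \<open>a\<close> leads from \<open>x\<close> to \<open>x\<close> only, and
    \<open>a * 1 = a\<close>.\<close>
  have one: "y = x" if xy: "(x, y) \<in> r 1" for x y
  proof -
    obtain a where "r a `` {x} = {x}"
      using point xy subset by blast
    moreover from this have "(x, y) \<in> r (a * 1)"
      using xy unfolding rep_mult by blast
    ultimately show ?thesis
      by auto
  qed
  \<comment> \<open>An element leading from \<open>x\<close> to \<open>y\<close> only is a join of
    words, one of which must reach \<open>y\<close> and none of which reaches another point.\<close>
  have word: "\<exists>w. (x, y) \<in> r (pen_word w) \<and> r (pen_word w) `` {x} \<subseteq> {y}"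
    if xy: "x \<in> X" "y \<in> X" for x y
  proof -
    obtain a where a: "r a `` {x} = {y}"
      using point[OF xy] ..
    obtain W where W: "a = (SUP w\<in>W. pen_word w)"
      by (rule pen_eq_SUP_words)
    then have "r a = (\<Union>w\<in>W. r (pen_word w))"
      by (simp add: rep_Sup)
    with a show ?thesis
      by blast
  qed
  have conn_word: "connected x y" if "(x, y) \<in> r (pen_word w)" for x y w
    using that
  proof (induction w arbitrary: y rule: rev_induct)
    case Nil
    then show ?case
      using one subset connected_refl unfolding rep_word_Nil by blast
  next
    case (snoc l w)
    then show ?case
      unfolding rep_word_snoc by (blast intro: connected_letter)
  qed
  then have conn: "connected x y" if "x \<in> X" "y \<in> X" for x y
    using word[OF that] by blast
  have "inj_on seq X"
  proof (rule inj_onI)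
    fix x y assume x: "x \<in> X" and y: "y \<in> X" and eq: "seq x = seq y"
    obtain w where w: "(x, y) \<in> r (pen_word w)" "r (pen_word w) `` {x} \<subseteq> {y}"
      using word[OF x y] by blast
    \<comment> \<open>Only the last letter sees the end point. Its arrows depend on sequences alone,
      so from the point before the last step it reaches \<open>x\<close> as well as
      \<open>y\<close>.\<close>
    show "x = y"
    proof (cases w rule: rev_exhaust)
      case Nil
      then show ?thesis
        using w(1) one unfolding Nil rep_word_Nil by blast
    next
      case (snoc v l)
      then obtain z where z: "(x, z) \<in> r (pen_word v)"
        "(z, y) \<in> r (eval_letter (\<lambda>(A, n). bra A n) l)"
        using w(1) unfolding snoc rep_word_snoc by blast
      have "z \<in> X"
        using z subset by blast
      then have "(z, x) \<in> r (eval_letter (\<lambda>(A, n). bra A n) l)"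
        using z(2) conn x y eq by (cases l) (auto simp: rep_invol connected_bra_iff)
      then have "x \<in> r (pen_word w) `` {x}"
        using z(1) unfolding snoc rep_word_snoc by blast
      with w(2) show ?thesis
        by blast
    qed
  qed
  moreover have "seq ` X = tail_equivalence `` {seq x0}"
  proof (intro equalityI subsetI)
    fix t assume "t \<in> tail_equivalence `` {seq x0}"
    then have "(seq x0, t) \<in> tail_equivalence"
      by simp
    then obtain y A n where y: "(x0, y) \<in> r (chain bra A (Suc n))"
      and "\<forall>z. (x0, z) \<in> r (chain bra A (Suc n)) \<longrightarrow> seq z = t"
      by (rule chain_reaches[OF x0])
    then have "seq y = t"
      by simp
    with y show "t \<in> seq ` X"
      using subset by blast
  qed (use conn x0 connected_tail in blast)
  moreover have "tail_equivalence `` {seq x0} \<in> penrose_classes"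
    using seq_penrose[OF x0] by (rule quotientI)
  ultimately show ?thesis
    unfolding bij_betw_def by blast
qed

text \<open>A chain from \<open>x\<close> reaches a point with the sequence of \<open>y\<close>,
  which is \<open>y\<close> by injectivity. All points are therefore connected, and
  \<open>connected_bra_iff\<close> applies.\<close>

lemma bra_iff_if_bij:
  assumes c: "c \<in> penrose_classes" and bij: "bij_betw seq X c" and x: "x \<in> X" and y: "y \<in> X"
  shows "(x, y) \<in> r (bra A n) \<longleftrightarrow> pen_step A n (seq x) (seq y)"
proof (rule connected_bra_iff)
  have "(seq x, seq y) \<in> tail_equivalence"
    using x y bij by (intro penrose_class_related[OF c]) (auto simp: bij_betw_def)
  then obtain y' A n where y': "(x, y') \<in> r (chain bra A (Suc n))"
    and "\<forall>z. (x, z) \<in> r (chain bra A (Suc n)) \<longrightarrow> seq z = seq y"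
    by (rule chain_reaches[OF x])
  then have "seq y' = seq y"
    by simp
  moreover have "y' \<in> X"
    using y' subset by blast
  ultimately have "y' = y"
    using y by (intro inj_onD[OF bij_betw_imp_inj_on[OF bij]])
  with y' show "connected x y"
    using chain_le_bra unfolding connected_def by blast
qed

lemma one_if_inj: "inj_on seq X \<Longrightarrow> r 1 = Id_on X"
  using rep_one seq_one subset by (fastforce dest: inj_onD)

end


section \<open>Equivalence of representations\<close>

lemma rep_equivalentI:
  assumes r: "\<And>a. r a \<subseteq> X \<times> X" and r': "\<And>a. r' a \<subseteq> X' \<times> X'"
    and g: "bij_betw g X X'"
    and rel: "\<And>a x y. x \<in> X \<Longrightarrow> y \<in> X \<Longrightarrow> (x, y) \<in> r a \<longleftrightarrow> (g x, g y) \<in> r' a"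
  shows "rep_equivalent X r X' r'"
  unfolding rep_equivalent_def
proof (intro exI[of _ "image g"] conjI allI impI)
  show "bij_betw ((`) g) (Pow X) (Pow X')"
    using g by (rule bij_betw_Pow)
  show "g ` \<Union>\<Z> = \<Union> ((`) g ` \<Z>)" for \<Z>
    by blast
  show "g ` (r a `` Z) = r' a `` (g ` Z)" if Z: "Z \<subseteq> X" for Z a
  proof (intro equalityI subsetI)
    fix y assume "y \<in> r' a `` (g ` Z)"
    then obtain x where x: "x \<in> Z" "(g x, y) \<in> r' a"
      by blast
    then obtain z where "z \<in> X" "y = g z"
      using r' g by (blast dest: bij_betw_imp_surj_on)
    with x Z rel show "y \<in> g ` (r a `` Z)"
      by blast
  qed (use r rel Z in blast)
  show "Y \<inter> Z = {} \<longleftrightarrow> g ` Y \<inter> g ` Z = {}" if "Y \<subseteq> X" "Z \<subseteq> X" for Y Z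
    using inj_on_image_Int[OF bij_betw_imp_inj_on[OF g] that] by auto
qed

text \<open>An isomorphism of power sets maps atoms to atoms and hence comes from a bijection of
  points.\<close>

lemma rep_equivalentE:
  assumes "rep_equivalent X r X' r'" and r: "\<And>a. r a \<subseteq> X \<times> X"
  obtains g where "bij_betw g X X'"
    "\<And>a x y. x \<in> X \<Longrightarrow> y \<in> X \<Longrightarrow> (x, y) \<in> r a \<longleftrightarrow> (g x, g y) \<in> r' a"
proof -
  obtain f where f: "bij_betw f (Pow X) (Pow X')"
    and Union: "\<And>\<Z>. \<Z> \<subseteq> Pow X \<Longrightarrow> f (\<Union>\<Z>) = \<Union>(f ` \<Z>)"
    and act: "\<And>Z a. Z \<subseteq> X \<Longrightarrow> f (r a `` Z) = r' a `` f Z"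
    using assms(1) unfolding rep_equivalent_def by metis
  have inj: "Y = Z" if "f Y = f Z" "Y \<subseteq> X" "Z \<subseteq> X" for Y Z
    using inj_onD[OF bij_betw_imp_inj_on[OF f] that(1)] that by blast
  have sub: "f Z \<subseteq> X'" if "Z \<subseteq> X" for Z
    using bij_betw_imp_surj_on[OF f] that by blast
  have empty: "f {} = {}"
    using Union[of "{}"] by simp
  have "\<exists>y\<in>X'. f {x} = {y}" if x: "x \<in> X" for x
  proof -
    have "f {x} \<noteq> {}"
      using inj[of "{x}" "{}"] x empty by auto
    then obtain y where y: "y \<in> f {x}"
      by blast
    \<comment> \<open>The preimage \<open>W\<close> of a singleton inside \<open>f {x}\<close>
      satisfies \<open>f (W \<union> {x}) = f {x}\<close>, so it is contained in \<open>{x}\<close>;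
      being nonempty, it equals \<open>{x}\<close>.\<close>
    then have "{y} \<in> f ` Pow X"
      using sub[of "{x}"] x bij_betw_imp_surj_on[OF f] by auto
    then obtain W where W: "W \<subseteq> X" "f W = {y}"
      by auto
    have "f (W \<union> {x}) = f {x}"
      using Union[of "{W, {x}}"] W x y by auto
    then have "W \<subseteq> {x}"
      using inj[of "W \<union> {x}" "{x}"] W x by auto
    moreover have "W \<noteq> {}"
      using W empty by auto
    ultimately have "W = {x}"
      by blast
    then show ?thesis
      using W sub[of W] by auto
  qed
  then obtain g where g: "\<And>x. x \<in> X \<Longrightarrow> g x \<in> X' \<and> f {x} = {g x}"
    by metis
  have image: "f Z = g ` Z" if "Z \<subseteq> X" for Z
  proof -
    have "(\<lambda>x. {x}) ` Z \<subseteq> Pow X"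
      using that by blast
    then have "f Z = (\<Union>x\<in>Z. f {x})"
      using Union[of "(\<lambda>x. {x}) ` Z"] by (simp add: image_image)
    also have "\<dots> = (\<Union>x\<in>Z. {g x})"
      using that g by (intro SUP_cong) auto
    also have "\<dots> = g ` Z"
      by blast
    finally show ?thesis .
  qed
  have "bij_betw g X X'"
    unfolding bij_betw_def
  proof
    show "inj_on g X"
      using g inj by (metis empty_subsetI inj_onI insert_subset singleton_inject)
    obtain Z where Z: "Z \<subseteq> X" "f Z = X'"
      using bij_betw_imp_surj_on[OF f] by (metis Pow_iff Pow_top imageE)
    show "g ` X = X'"
    proof
      show "X' \<subseteq> g ` X"
        using image[OF Z(1)] Z by blast
    qed (use g in blast)
  qed
  moreover have "(x, y) \<in> r a \<longleftrightarrow> (g x, g y) \<in> r' a" if "x \<in> X" "y \<in> X" for a x y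
  proof -
    have "g ` (r a `` {x}) = r' a `` {g x}"
      using act[of "{x}" a] image[of "r a `` {x}"] g[of x] r[of a] that by auto
    moreover have "g y \<in> g ` (r a `` {x}) \<longleftrightarrow> y \<in> r a `` {x}"
      using \<open>bij_betw g X X'\<close> r[of a] that
      by (intro inj_on_image_mem_iff[of g X]) (auto dest: bij_betw_imp_inj_on)
    ultimately show ?thesis
      by auto
  qed
  ultimately show thesis
    by (rule that)
qed

section \<open>Equivalence in terms of tiling sequences\<close>

lemma rel_rep_subset: "rel_rep X r \<Longrightarrow> r a \<subseteq> X \<times> X"
  by (simp add: rel_rep_def)

lemma bij_tiling_seq_if_equivalent:
  assumes r: "rel_rep X r" and eq: "rep_equivalent X r X' r'"
    and bij: "bij_betw (tiling_seq r') X' c"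
  shows "bij_betw (tiling_seq r) X c"
proof -
  obtain g where g: "bij_betw g X X'"
    and rel: "\<And>a x y. x \<in> X \<Longrightarrow> y \<in> X \<Longrightarrow> (x, y) \<in> r a \<longleftrightarrow> (g x, g y) \<in> r' a"
    using rep_equivalentE[OF eq rel_rep_subset[OF r]] by blast
  have "bij_betw (tiling_seq r' \<circ> g) X c"
    using g bij by (rule bij_betw_trans)
  moreover have "(tiling_seq r' \<circ> g) x = tiling_seq r x" if "x \<in> X" for x
    using rel that by (auto simp: tiling_seq_def)
  ultimately show ?thesis
    using bij_betw_cong by blast
qed

text \<open>By \<open>bra_iff_if_bij\<close> the generators depend on sequences alone in both
  representations. Agreement then extends to adjoints, words and joins.\<close>

lemma seq_preserving_bij_rel:
  assumes r: "rel_rep X r" and r': "rel_rep X' r'" and c: "c \<in> penrose_classes"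
    and bij: "bij_betw (tiling_seq r) X c" and bij': "bij_betw (tiling_seq r') X' c"
    and g: "bij_betw g X X'" and seq: "\<And>x. x \<in> X \<Longrightarrow> tiling_seq r' (g x) = tiling_seq r x"
    and x: "x \<in> X" and y: "y \<in> X"
  shows "(x, y) \<in> r a \<longleftrightarrow> (g x, g y) \<in> r' a"
proof -
  interpret R: pen_representation X r
    using r by unfold_locales
  interpret R': pen_representation X' r'
    using r' by unfold_locales
  have gX: "g x \<in> X'" if "x \<in> X" for x
    using g that by (rule bij_betwE[rule_format])
  have bra: "(x, y) \<in> r (bra A n) \<longleftrightarrow> (g x, g y) \<in> r' (bra A n)" if "x \<in> X" "y \<in> X" for x y A n
    using that by (simp add: R.bra_iff_if_bij[OF c bij] R'.bra_iff_if_bij[OF c bij'] gX seq)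
  have letter: "(x, y) \<in> r (eval_letter (\<lambda>(A, n). bra A n) l) \<longleftrightarrow>
      (g x, g y) \<in> r' (eval_letter (\<lambda>(A, n). bra A n) l)" if "x \<in> X" "y \<in> X" for x y l
    using that by (cases l) (auto simp: bra R.rep_invol R'.rep_invol)
  have word: "(x, y) \<in> r (pen_word w) \<longleftrightarrow> (g x, g y) \<in> r' (pen_word w)" if "x \<in> X" "y \<in> X" for y w
    using that(2)
  proof (induction w arbitrary: y rule: rev_induct)
    case Nil
    have "r 1 = Id_on X" "r' 1 = Id_on X'"
      using bij bij' by (simp_all add: bij_betw_def R.one_if_inj R'.one_if_inj)
    then show ?case
      unfolding R.rep_word_Nil R'.rep_word_Nil
      using inj_on_eq_iff[OF bij_betw_imp_inj_on[OF g] \<open>x \<in> X\<close> \<open>y \<in> X\<close>] gX that(1) Nil by auto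
  next
    case (snoc l w)
    show ?case
    proof
      assume "(x, y) \<in> r (pen_word (w @ [l]))"
      then show "(g x, g y) \<in> r' (pen_word (w @ [l]))"
        unfolding R.rep_word_snoc R'.rep_word_snoc
        using snoc R.subset letter by blast
    next
      assume "(g x, g y) \<in> r' (pen_word (w @ [l]))"
      then obtain z' where z': "(g x, z') \<in> r' (pen_word w)"
        "(z', g y) \<in> r' (eval_letter (\<lambda>(A, n). bra A n) l)"
        unfolding R'.rep_word_snoc by blast
      then obtain z where "z \<in> X" "z' = g z"
        using R'.subset g by (blast dest: bij_betw_imp_surj_on)
      then show "(x, y) \<in> r (pen_word (w @ [l]))"
        unfolding R.rep_word_snoc using z' snoc letter by blast
    qed
  qed
  obtain W where "a = (SUP w\<in>W. pen_word w)"
    by (rule pen_eq_SUP_words)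
  then show ?thesis
    using word[OF x y] by (simp add: R.rep_Sup R'.rep_Sup)
qed

lemma equivalent_if_bij_tiling_seq:
  assumes r: "rel_rep X r" and r': "rel_rep X' r'" and c: "c \<in> penrose_classes"
    and bij: "bij_betw (tiling_seq r) X c" and bij': "bij_betw (tiling_seq r') X' c"
  shows "rep_equivalent X r X' r'"
proof -
  \<comment> \<open>This sends \<open>x\<close> to the point of \<open>X'\<close> with the same
    tiling sequence.\<close>
  define g where "g = the_inv_into X' (tiling_seq r') \<circ> tiling_seq r"
  have g: "bij_betw g X X'"
    unfolding g_def using bij bij_betw_the_inv_into[OF bij'] by (rule bij_betw_trans)
  have "tiling_seq r' (g x) = tiling_seq r x" if "x \<in> X" for x
    unfolding g_def comp_apply using that bij bij'
    by (intro f_the_inv_into_f_bij_betw) (auto dest: bij_betwE)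
  then show ?thesis
    by (intro rep_equivalentI[of r X r' X' g] rel_rep_subset r r' g
        seq_preserving_bij_rel[OF r r' c bij bij' g])
qed

text \<open>This moves representations between types. Injectivity ensures that arrows compose
  whenever their images do.\<close>

lemma rel_rep_image:
  assumes r: "rel_rep X r" and g: "inj_on g X"
  shows "rel_rep (g ` X) (\<lambda>a. map_prod g g ` r a)"
  unfolding rel_rep_def
proof (intro conjI allI)
  have sub: "r a \<subseteq> X \<times> X" for a
    using r by (rule rel_rep_subset)
  have rep: "r (Sup A) = (\<Union>a\<in>A. r a)" "r (a * b) = r a O r b" "r (a\<^sup>\<star>) = (r a)\<inverse>" "Id_on X \<subseteq> r 1"
    for A a b
    using r by (auto simp: rel_rep_def)
  show "map_prod g g ` r a \<subseteq> g ` X \<times> g ` X" for a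
    using sub by fastforce
  show "map_prod g g ` r (Sup A) = (\<Union>a\<in>A. map_prod g g ` r a)" for A
    by (auto simp: rep)
  show "map_prod g g ` r (a * b) = (map_prod g g ` r a) O (map_prod g g ` r b)" for a b
  proof (intro equalityI subsetI)
    fix p assume "p \<in> (map_prod g g ` r a) O (map_prod g g ` r b)"
    then obtain x y y' z where *: "(x, y) \<in> r a" "(y', z) \<in> r b" "g y = g y'" "p = (g x, g z)"
      by auto
    moreover have "y = y'"
      using * sub g by (blast dest: inj_onD)
    ultimately have "(x, z) \<in> r (a * b)"
      by (auto simp: rep)
    with * show "p \<in> map_prod g g ` r (a * b)"
      by force
  qed (auto simp: rep)
  show "map_prod g g ` r (a\<^sup>\<star>) = (map_prod g g ` r a)\<inverse>" for a
    by (auto simp: rep)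
  show "Id_on (g ` X) \<subseteq> map_prod g g ` r 1"
    using rep(4) by force
qed

lemma tiling_seq_image:
  assumes r: "rel_rep X r" and g: "inj_on g X" and x: "x \<in> X"
  shows "tiling_seq (\<lambda>a. map_prod g g ` r a) (g x) = tiling_seq r x"
proof -
  have "(g x, g x) \<in> map_prod g g ` r a \<longleftrightarrow> (x, x) \<in> r a" for a
  proof
    assume "(g x, g x) \<in> map_prod g g ` r a"
    then obtain y z where yz: "(y, z) \<in> r a" "g y = g x" "g z = g x"
      by auto
    then have "y = x" "z = x"
      using rel_rep_subset[OF r, of a] x by (auto intro: inj_onD[OF g])
    with yz show "(x, x) \<in> r a"
      by simp
  qed force
  then show ?thesis
    by (simp add: tiling_seq_def fun_eq_iff)
qed


section \<open>The canonical representations\<close>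

text \<open>With the Penrose sequences as a type, their diagonal is the unit of
  \<open>penrose_seq relation\<close>, so that the strictly unital homomorphism out of
  \<open>pen\<close> yields a representation on exactly these sequences.\<close>

typedef penrose_seq = penrose_seqs
proof
  show "(\<lambda>_. 0) \<in> penrose_seqs"
    by (simp add: penrose_seqs_def)
qed

abbreviation step_rel :: "tile \<Rightarrow> nat \<Rightarrow> penrose_seq rel" where
  "step_rel A n \<equiv> {(s, t). pen_step A n (Rep_penrose_seq s) (Rep_penrose_seq t)}"

lift_definition step_family :: "tile \<Rightarrow> nat \<Rightarrow> penrose_seq relation" is step_rel .

text \<open>Only \<open>C'\<close> asks for a sequence to be constructed; the other relations
  compare entries of given ones.\<close>

lemma penrose_family_step: "penrose_family step_family"
  unfolding penrose_family_def
proof (intro allI impI)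
  note Rep_simps = less_eq_relation.rep_eq Rep_relation_simps step_family.rep_eq
  note cases = penrose_seq_cases[OF Rep_penrose_seq]
  fix u v assume "pen_rel step_family u v"
  then show "u \<le> v"
  proof cases
    case (C1 n)
    show ?thesis
      unfolding C1 Rep_simps by (auto simp: pen_step_def)
  next
    case (C2 n)
    show ?thesis
      unfolding C2 Rep_simps
      using penrose_seq_Suc[OF Rep_penrose_seq] by (auto simp: pen_step_def)
  next
    case (D1 n)
    have "(s, s) \<in> step_rel L n \<union> step_rel S n" for s
      by (rule cases[of s n]) (auto simp: pen_step_def)
    then show ?thesis
      unfolding D1 Rep_simps by blast
  next
    case (D2 A n)
    have "(s, t) \<in> step_rel S n \<union> step_rel L n"
      if u: "(u, s) \<in> step_rel A (Suc n)" "(u, t) \<in> step_rel A (Suc n)" for s t u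
    proof -
      \<comment> \<open>Both sequences agree with \<open>u\<close> beyond \<open>Suc n\<close> and
        carry \<open>A\<close> at \<open>Suc n\<close>.\<close>
      have "Rep_penrose_seq s m = Rep_penrose_seq t m" if "m > n" for m
        using u that by (cases "m = Suc n") (auto simp: pen_step_def)
      then show ?thesis
        by (rule_tac cases[of t n]) (auto simp: pen_step_def)
    qed
    then show ?thesis
      unfolding D2 Rep_simps by blast
  next
    case (E1 B n A)
    show ?thesis
      unfolding E1 Rep_simps by (auto simp: pen_step_def)
  next
    case (E2 A n B)
    show ?thesis
      unfolding E2 Rep_simps by (auto simp: pen_step_def)
  next
    case (E3 B n A)
    show ?thesis
      unfolding E3 Rep_simps by (auto simp: pen_step_def)
  next
    case (E4 A n B)
    show ?thesis
      unfolding E4 Rep_simps by (auto simp: pen_step_def)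
  next
    case (C' n A)
    let ?c = "Rep_relation (chain step_family A (Suc n))"
    have "\<exists>t. (s, t) \<in> ?c" for s
    proof -
      \<comment> \<open>The end point of the chain is \<open>s\<close> overwritten by
        \<open>A\<close> up to \<open>n\<close>. Since \<open>A n = L\<close>, no two consecutive
        ones can arise at the junction.\<close>
      define t where "t = (\<lambda>m. if m \<le> n then tile_bit (A m) else Rep_penrose_seq s m)"
      have "t m \<in> {0, 1}" for m
        by (cases "A m"; rule cases[of s m]) (auto simp: t_def)
      moreover have "t (Suc m) = 0" if m: "t m = 1" for m
      proof -
        consider "m < n" | "m = n" | "m > n"
          by linarith
        then show ?thesis
        proof cases
          case 1
          then have "A m = S"
            using m by (cases "A m") (auto simp: t_def)
          with 1 C' show ?thesis
            by (simp add: t_def admissible_def)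
        next
          case 2
          then show ?thesis
            using m C' by (simp add: t_def)
        next
          case 3
          then show ?thesis
            using m penrose_seq_Suc[OF Rep_penrose_seq, of s m] by (simp add: t_def)
        qed
      qed
      ultimately have "t \<in> penrose_seqs"
        unfolding penrose_seqs_def by blast
      then have t: "Rep_penrose_seq (Abs_penrose_seq t) = t"
        by (rule Abs_penrose_seq_inverse)
      let ?t = "Abs_penrose_seq t"
      \<comment> \<open>After the first step, from \<open>s\<close> to \<open>t\<close> at level
        \<open>n\<close>, the rest of the chain can stay at \<open>t\<close>.\<close>
      have "(?t, ?t) \<in> Rep_relation (chain step_family A k)" if "k \<le> n" for k
        using that
      proof (induction k)
        case (Suc k)
        then have "(?t, ?t) \<in> Rep_relation (step_family (A k) k)"
          unfolding step_family.rep_eq by (simp add: t pen_step_def) (simp add: t_def)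
        with Suc show ?case
          by (auto simp: Rep_relation_simps)
      qed (simp add: Rep_relation_simps)
      moreover have "(s, ?t) \<in> Rep_relation (step_family (A n) n)"
        unfolding step_family.rep_eq by (simp add: t pen_step_def) (simp add: t_def)
      ultimately show ?thesis
        by (auto simp: Rep_relation_simps)
    qed
    then have "Id \<subseteq> ?c O ?c\<inverse>"
      by blast
    then have "1 \<le> chain step_family A (Suc n) * (chain step_family A (Suc n))\<^sup>\<star>"
      unfolding less_eq_relation.rep_eq Rep_relation_simps .
    then show ?thesis
      unfolding C' invol_chain by (simp add: chain_def del: upt_Suc)
  qed
qed

text \<open>
  The classes cannot be treated one at a time, since they are not types. Instead all Penrose
  sequences are represented at once; the representation relates equivalent sequences only, and
  therefore restricts to every class.
\<close>

lemma canonical_rep_exists: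
  assumes c: "c \<in> penrose_classes"
  shows "\<exists>r. rel_rep c r \<and> (\<forall>s\<in>c. tiling_seq r s = s)"
proof -
  obtain h where h: "strictly_unital_hom h" and bra: "\<And>A n. h (bra A n) = step_family A n"
    using pen_universal[OF penrose_family_step] by blast
  note hom = strictly_unital_homD[OF h]
  define R where "R = (\<lambda>a. Rep_relation (h a))"
  have R: "R (Sup A) = (\<Union>a\<in>A. R a)" "R (a * b) = R a O R b" "R (a\<^sup>\<star>) = (R a)\<inverse>" "R 1 = Id"
    "R (bra B n) = step_rel B n"
    for A a b B n
    by (simp_all add: R_def hom bra Rep_relation_simps step_family.rep_eq)
  let ?T = "inv_image tail_equivalence Rep_penrose_seq"
  have refl: "(s, s) \<in> ?T" for s
    using equiv_tail_equivalence Rep_penrose_seq[of s] by (auto simp: equiv_def refl_on_def)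
  have sym: "sym ?T" and trans: "trans ?T"
    using equiv_tail_equivalence by (auto simp: equiv_def sym_inv_image trans_inv_image)
  note step = pen_step_tail_equivalence[OF _ Rep_penrose_seq Rep_penrose_seq]
  have letter: "R (eval_letter (\<lambda>(A, n). bra A n) l) \<subseteq> ?T" for l
    using step sym by (cases l) (auto simp: R sym_def)
  have word: "R (pen_word w) \<subseteq> ?T" for w
  proof (induction w)
    case Nil
    then show ?case
      using refl by (auto simp: eval_word_def R)
  next
    case (Cons l w)
    have "R (pen_word (l # w)) = R (eval_letter (\<lambda>(A, n). bra A n) l) O R (pen_word w)"
      by (simp add: eval_word_def R)
    also have "\<dots> \<subseteq> ?T O ?T"
      using letter Cons.IH by (rule relcomp_mono)
    also have "\<dots> \<subseteq> ?T"
      using trans by (rule trans_O_subset)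
    finally show ?case .
  qed
  \<comment> \<open>A class is therefore closed under all of \<open>R\<close>, so cutting down to
    one class preserves composition.\<close>
  have tail: "R a \<subseteq> ?T" for a
  proof -
    obtain W where "a = (SUP w\<in>W. pen_word w)"
      by (rule pen_eq_SUP_words)
    with word show ?thesis
      by (auto simp: R)
  qed
  define C where "C = {s. Rep_penrose_seq s \<in> c}"
  have C: "Rep_penrose_seq ` C = c"
  proof -
    have "c \<subseteq> range Rep_penrose_seq"
      using penrose_class_related[OF c]
      by (auto simp: tail_equivalence_def Rep_penrose_seq_induct type_definition.Rep_range[OF type_definition_penrose_seq])
    then show ?thesis
      by (auto simp: C_def)
  qed
  have closed: "s \<in> C \<Longrightarrow> (s, t) \<in> R a \<Longrightarrow> t \<in> C" for s t a
    using tail[of a] penrose_class_closed[OF c] by (auto simp: C_def)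
  define r where "r = (\<lambda>a. R a \<inter> C \<times> C)"
  have r: "rel_rep C r"
    unfolding rel_rep_def r_def using closed by (auto simp: R)
  have seq: "tiling_seq r s = Rep_penrose_seq s" if "s \<in> C" for s
  proof
    fix n
    have "(s, s) \<in> r (bra L n) \<longleftrightarrow> Rep_penrose_seq s n = 0"
      using that by (simp add: r_def R pen_step_def)
    then show "tiling_seq r s n = Rep_penrose_seq s n"
      by (rule_tac penrose_seq_cases[OF Rep_penrose_seq, of s n]) (auto simp: tiling_seq_def)
  qed
  have inj: "inj_on Rep_penrose_seq C"
    by (simp add: inj_on_def Rep_penrose_seq_inject)
  have "rel_rep c (\<lambda>a. map_prod Rep_penrose_seq Rep_penrose_seq ` r a)"
    using rel_rep_image[OF r inj] unfolding C .
  moreover have "\<forall>s\<in>c. tiling_seq (\<lambda>a. map_prod Rep_penrose_seq Rep_penrose_seq ` r a) s = s"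
    using tiling_seq_image[OF r inj] seq C by force
  ultimately show ?thesis
    by blast
qed

section \<open>Uniqueness of the canonical representation\<close>

lemma bij_betw_if_fixes: "(\<And>s. s \<in> c \<Longrightarrow> f s = s) \<Longrightarrow> bij_betw f c c"
  by (metis bij_betw_cong bij_betw_id id_apply)

text \<open>Uniqueness is \<open>seq_preserving_bij_rel\<close> for the identity map. It justifies
  the definite description in \<open>canonical_rep\<close>.\<close>

lemma canonical_rep_ex1:
  assumes c: "c \<in> penrose_classes"
  shows "\<exists>!r. rel_rep c r \<and> (\<forall>s\<in>c. tiling_seq r s = s)"
proof (rule ex_ex1I[OF canonical_rep_exists[OF c]])
  fix r r' :: "pen \<Rightarrow> (nat \<Rightarrow> nat) rel"
  assume r: "rel_rep c r \<and> (\<forall>s\<in>c. tiling_seq r s = s)"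
    and r': "rel_rep c r' \<and> (\<forall>s\<in>c. tiling_seq r' s = s)"
  have iff: "(s, t) \<in> r a \<longleftrightarrow> (s, t) \<in> r' a" if "s \<in> c" "t \<in> c" for a s t
    using seq_preserving_bij_rel[of c r c r' c id s t a] r r' c that
    by (simp add: bij_betw_if_fixes)
  show "r = r'"
  proof
    fix a
    show "r a = r' a"
      using iff rel_rep_subset[of c r a] rel_rep_subset[of c r' a] r r' by auto
  qed
qed

lemma canonical_rep:
  assumes "c \<in> penrose_classes"
  shows "rel_rep c (canonical_rep c)" "bij_betw (tiling_seq (canonical_rep c)) c c"
  using theI'[OF canonical_rep_ex1[OF assms]] unfolding canonical_rep_def[symmetric]
  by (auto intro: bij_betw_if_fixes)


section \<open>Relational points\<close>

lemma alg_irreducible_iff: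
  assumes "rel_rep X r"
  shows "alg_irreducible X r \<longleftrightarrow> (\<exists>c\<in>penrose_classes. bij_betw (tiling_seq r) X c)"
proof -
  interpret pen_representation X r
    using assms by unfold_locales
  show ?thesis
    using alg_irreducible_if_bij bij_if_alg_irreducible by blast
qed

lemma rep_equivalent_canonical_iff:
  assumes "rel_rep X r" "c \<in> penrose_classes"
  shows "rep_equivalent X r c (canonical_rep c) \<longleftrightarrow> bij_betw (tiling_seq r) X c"
  using bij_tiling_seq_if_equivalent[OF assms(1) _ canonical_rep(2)[OF assms(2)]]
    equivalent_if_bij_tiling_seq[OF assms(1) canonical_rep(1)[OF assms(2)] assms(2) _
      canonical_rep(2)[OF assms(2)]]
  by blast

text \<open>For represented classes these sets turn out to be the relational points. The description
  by the sequence map makes sense over every type \<open>'x\<close>.\<close>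

definition reps_with_class :: "(nat \<Rightarrow> nat) set \<Rightarrow> ('x set \<times> (pen \<Rightarrow> 'x rel)) set" where
  "reps_with_class c = {(X, r). rel_rep X r \<and> bij_betw (tiling_seq r) X c}"

lemma irreducible_reps_eq: "irreducible_reps = (\<Union>c\<in>penrose_classes. reps_with_class c)"
  by (auto simp: irreducible_reps_def reps_with_class_def alg_irreducible_iff)

lemma reps_with_class_unique: "p \<in> reps_with_class c \<Longrightarrow> p \<in> reps_with_class d \<Longrightarrow> c = d"
  by (auto simp: reps_with_class_def bij_betw_def)

lemma rep_equivalence_class:
  fixes p :: "'x set \<times> (pen \<Rightarrow> 'x rel)"
  assumes c: "c \<in> penrose_classes" and p: "p \<in> reps_with_class c"
  shows "rep_equivalence `` {p} = reps_with_class c"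
proof -
  obtain X r where Xr: "p = (X, r)" "rel_rep X r" "bij_betw (tiling_seq r) X c"
    using p by (auto simp: reps_with_class_def)
  have p': "p \<in> irreducible_reps"
    unfolding irreducible_reps_eq using c p by blast
  show ?thesis
  proof (intro equalityI subsetI)
    fix q assume "q \<in> rep_equivalence `` {p}"
    then obtain X' r' where q: "q = (X', r')" "(X', r') \<in> irreducible_reps" "rep_equivalent X r X' r'"
      by (auto simp: rep_equivalence_def Xr)
    then obtain d where d: "q \<in> reps_with_class d"
      by (auto simp: irreducible_reps_eq)
    then have "bij_betw (tiling_seq r) X d"
      using bij_tiling_seq_if_equivalent[OF Xr(2) q(3)] by (auto simp: reps_with_class_def q)
    with Xr(3) have "d = c"
      by (simp add: bij_betw_def)
    with d show "q \<in> reps_with_class c"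
      by simp
  next
    fix q :: "'x set \<times> (pen \<Rightarrow> 'x rel)"
    assume q: "q \<in> reps_with_class c"
    then have "q \<in> irreducible_reps"
      unfolding irreducible_reps_eq using c by blast
    with q p' Xr show "q \<in> rep_equivalence `` {p}"
      by (auto simp: rep_equivalence_def reps_with_class_def
          intro: equivalent_if_bij_tiling_seq[OF Xr(2) _ c Xr(3)])
  qed
qed

text \<open>That each class is represented over \<open>'x\<close> prevents two classes from both
  yielding the empty set, which is not an equivalence class either.\<close>

lemma bij_betw_reps_with_class:
  assumes "\<And>c. c \<in> penrose_classes \<Longrightarrow> reps_with_class c \<noteq> ({} :: ('x set \<times> (pen \<Rightarrow> 'x rel)) set)"
  shows "bij_betw reps_with_class penrose_classes
    (relational_points :: ('x set \<times> (pen \<Rightarrow> 'x rel)) set set)"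
  unfolding bij_betw_def
proof
  show "inj_on (reps_with_class :: _ \<Rightarrow> ('x set \<times> (pen \<Rightarrow> 'x rel)) set) penrose_classes"
    using assms reps_with_class_unique by (metis ex_in_conv inj_onI)
  show "reps_with_class ` penrose_classes =
    (relational_points :: ('x set \<times> (pen \<Rightarrow> 'x rel)) set set)"
  proof (intro equalityI subsetI)
    fix P :: "('x set \<times> (pen \<Rightarrow> 'x rel)) set"
    assume "P \<in> reps_with_class ` penrose_classes"
    then obtain c where c: "c \<in> penrose_classes" "P = reps_with_class c"
      by blast
    then obtain p where p: "p \<in> P"
      using assms by blast
    have "p \<in> irreducible_reps"
      unfolding irreducible_reps_eq using c p by blast
    moreover have "rep_equivalence `` {p} = P"
      using rep_equivalence_class[OF c(1)] c(2) p by simp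
    ultimately show "P \<in> relational_points"
      unfolding relational_points_def by (blast intro: quotientI)
  next
    fix P :: "('x set \<times> (pen \<Rightarrow> 'x rel)) set"
    assume "P \<in> relational_points"
    then obtain p where "p \<in> irreducible_reps" "P = rep_equivalence `` {p}"
      unfolding relational_points_def by (blast elim: quotientE)
    moreover from this obtain c where "c \<in> penrose_classes" "p \<in> reps_with_class c"
      by (auto simp: irreducible_reps_eq)
    ultimately show "P \<in> reps_with_class ` penrose_classes"
      using rep_equivalence_class[of c p] by blast
  qed
qed

lemma canonical_in_reps_with_class:
  "c \<in> penrose_classes \<Longrightarrow> (c, canonical_rep c) \<in> reps_with_class c"
  by (simp add: reps_with_class_def canonical_rep)

text \<open>A class is countable, so its canonical representation can be copied along an injection
  into \<open>'x\<close>.\<close>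

lemma reps_with_class_nonempty:
  assumes "infinite (UNIV :: 'x set)" and c: "c \<in> penrose_classes"
  shows "reps_with_class c \<noteq> ({} :: ('x set \<times> (pen \<Rightarrow> 'x rel)) set)"
proof -
  obtain f :: "nat \<Rightarrow> 'x" where "inj f"
    using infinite_countable_subset[OF assms(1)] by blast
  define g where "g = f \<circ> to_nat_on c"
  have g: "inj_on g c"
    unfolding g_def using \<open>inj f\<close> inj_on_to_nat_on[OF countable_penrose_class[OF c]]
    by (simp add: comp_inj_on inj_on_subset)
  let ?r = "\<lambda>a. map_prod g g ` canonical_rep c a"
  have "bij_betw (tiling_seq ?r \<circ> g) c c"
    using canonical_rep(2)[OF c] tiling_seq_image[OF canonical_rep(1)[OF c] g]
    by (simp add: bij_betw_def inj_on_def)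
  then have "bij_betw (tiling_seq ?r) (g ` c) c"
    using bij_betw_comp_iff[OF inj_on_imp_bij_betw[OF g]] by blast
  then have "(g ` c, ?r) \<in> reps_with_class c"
    using rel_rep_image[OF canonical_rep(1)[OF c] g] by (simp add: reps_with_class_def)
  then show ?thesis
    by blast
qed

text \<open>The correspondence is stated on the type of sequences, where
  \<open>canonical_rep c\<close> itself belongs to its point, and over any infinite type, where a
  point can only be described through equivalence with it.\<close>

theorem corollary6p3:
  shows
    "(\<forall>c\<in>penrose_classes. \<exists>!r. rel_rep c r \<and> (\<forall>s\<in>c. tiling_seq r s = s)) \<and>
     (\<forall>(X :: 'x set) (r :: pen \<Rightarrow> 'x rel). rel_rep X r \<longrightarrow>
        (alg_irreducible X r \<longleftrightarrow>
          (\<exists>c\<in>penrose_classes. rep_equivalent X r c (canonical_rep c)))) \<and>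
     bij_betw (\<lambda>c. rep_equivalence `` {(c, canonical_rep c)}) penrose_classes
       (relational_points :: ((nat \<Rightarrow> nat) set \<times> (pen \<Rightarrow> (nat \<Rightarrow> nat) rel)) set set) \<and>
     (infinite (UNIV :: 'x set) \<longrightarrow>
       bij_betw
         (\<lambda>c. {(X, r). (X, r) \<in> irreducible_reps \<and> rep_equivalent X r c (canonical_rep c)})
         penrose_classes
         (relational_points :: ('x set \<times> (pen \<Rightarrow> 'x rel)) set set))"
proof (intro conjI impI)
  show "\<forall>c\<in>penrose_classes. \<exists>!r. rel_rep c r \<and> (\<forall>s\<in>c. tiling_seq r s = s)"
    using canonical_rep_ex1 by blast
  show "\<forall>(X :: 'x set) (r :: pen \<Rightarrow> 'x rel). rel_rep X r \<longrightarrow>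
      (alg_irreducible X r \<longleftrightarrow>
        (\<exists>c\<in>penrose_classes. rep_equivalent X r c (canonical_rep c)))"
    by (simp add: alg_irreducible_iff rep_equivalent_canonical_iff)
  have "rep_equivalence `` {(c, canonical_rep c)} = reps_with_class c" if "c \<in> penrose_classes" for c
    using that by (intro rep_equivalence_class canonical_in_reps_with_class)
  moreover have "bij_betw reps_with_class penrose_classes
      (relational_points :: ((nat \<Rightarrow> nat) set \<times> (pen \<Rightarrow> (nat \<Rightarrow> nat) rel)) set set)"
    using canonical_in_reps_with_class by (intro bij_betw_reps_with_class) blast
  ultimately show "bij_betw (\<lambda>c. rep_equivalence `` {(c, canonical_rep c)}) penrose_classes
      (relational_points :: ((nat \<Rightarrow> nat) set \<times> (pen \<Rightarrow> (nat \<Rightarrow> nat) rel)) set set)"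
    by (simp cong: bij_betw_cong)
  assume "infinite (UNIV :: 'x set)"
  then have "bij_betw reps_with_class penrose_classes
      (relational_points :: ('x set \<times> (pen \<Rightarrow> 'x rel)) set set)"
    by (intro bij_betw_reps_with_class reps_with_class_nonempty)
  \<comment> \<open>\<open>rep_equivalent_canonical_iff\<close> exchanges equivalence with the
    canonical representation for bijectivity of the sequence map onto \<open>c\<close>, which
    already implies irreducibility.\<close>
  moreover have "{(X, r). (X, r) \<in> irreducible_reps \<and> rep_equivalent X r c (canonical_rep c)} =
      (reps_with_class c :: ('x set \<times> (pen \<Rightarrow> 'x rel)) set)" if "c \<in> penrose_classes" for c
    using that
    by (auto simp: irreducible_reps_def reps_with_class_def alg_irreducible_iff
        rep_equivalent_canonical_iff)
  ultimately show "bij_betw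
      (\<lambda>c. {(X, r). (X, r) \<in> irreducible_reps \<and> rep_equivalent X r c (canonical_rep c)})
      penrose_classes (relational_points :: ('x set \<times> (pen \<Rightarrow> 'x rel)) set set)"
    by (simp cong: bij_betw_cong)
qed

end
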